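(* Let $m\ge 1$ and let $A_{k\ell}\in\mathbb C^{n_k\times n_k}$ ($k=1,\dots,m$, $\ell=0,\dots,m$) be Hermitian matrices such that the associated multiparameter eigenvalue problem is right definite. Let $\mathbf i=(i_1,\dots,i_m)\in\{1,\dots,n_1\}\times\dots\times\{1,\dots,n_m\}$ and let $\lambda^{\mathbf i}\in\mathbb R^m$ be the unique eigenvalue of multiindex $\mathbf i$, i.e. the unique zero of $F_{\mathbf i}$. Then the semismooth Newton method applied to $F_{\mathbf i}$ converges locally quadratically to $\lambda^{\mathbf i}$: there exist a neighborhood $U\subset\mathbb R^m$ of $\lambda^{\mathbf i}$ and a constant $C<\infty$ such that, for every $\lambda^{(0)}\in U$ and every choice of elements $J_j\in\partial F_{\mathbf i}(\lambda^{(j)})$, the iteration $$F_{\mathbf i}(\lambda^{(j)})+J_j\,(\lambda^{(j+1)}-\lambda^{(j)})=0,\qquad j=0,1,2,\dots,$$ is well defined (each $J_j$ is invertible), converges to $\lambda^{\mathbf i}$, and satisfies $\|\lambda^{(j+1)}-\lambda^{\mathbf i}\|\le C\,\|\lambda^{(j)}-\lambda^{\mathbf i}\|^2$ for all $j\ge 0$.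
   Context: $\|\cdot\|$ is the Euclidean norm. $\mathcal U_k$ is the set of unit vectors in $\mathbb C^{n_k}$, and $\mathsf H$ denotes conjugate transpose. The multiparameter eigenvalue problem (MEP) asks for $\lambda=(\lambda_1,\dots,\lambda_m)$ and $u_k\in\mathcal U_k$ with $\bigl(A_{k0}+\sum_{\ell=1}^m\lambda_\ell A_{k\ell}\bigr)u_k=0$ for $k=1,\dots,m$; such a $\lambda$ is an eigenvalue. Right definite: $\det\bigl(u_k^{\mathsf H}A_{k\ell}u_k\bigr)_{k,\ell=1}^m>0$ for all $u_k\in\mathcal U_k$, $k=1,\dots,m$. For $\lambda\in\mathbb R^m$, $\varepsilon_{k,i}(\lambda)$ denotes the $i$-th largest eigenvalue (counted with multiplicity) of the Hermitian matrix $A_{k0}+\sum_{\ell=1}^m\lambda_\ell A_{k\ell}$, and $F_{\mathbf i}:\mathbb R^m\to\mathbb R^m$, $F_{\mathbf i}(\lambda)=(\varepsilon_{1,i_1}(\lambda),\dots,\varepsilon_{m,i_m}(\lambda))$. An eigenvalue $\lambda\in\mathbb R^m$ has multiindex $\mathbf i$ if $F_{\mathbf i}(\lambda)=0$. It is a known fact that for a right definite MEP, $F_{\mathbf i}$ has exactly one zero in $\mathbb R^m$ for every multiindex $\mathbf i$. For a Lipschitz continuous $\Phi:\mathbb R^n\to\mathbb R^p$, Clarke's generalized Jacobian $\partial\Phi(x)$ is the convex hull of all limits $\lim_{j\to\infty}\Phi'(x_j)$ over sequences $x_j\to x$ of points at which $\Phi$ is differentiable and for which the limit exists. ($F_{\mathbf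 i}$ is Lipschitz continuous.) *)

theory Defs
  imports
    "HOL-Analysis.Analysis"
    "Jordan_Normal_Form.Schur_Decomposition"
begin

no_notation vec_index (infixl "$" 100)

definition hermitian_mat :: "complex mat \<Rightarrow> bool" where
  "hermitian_mat M \<longleftrightarrow> mat_adjoint M = M"

definition unit_vecs :: "nat \<Rightarrow> complex Matrix.vec set" where
  "unit_vecs n = {u \<in> carrier_vec n. u \<bullet>c u = 1}"

text \<open>
  The rows and columns of the parameter matrix, and the parameters themselves, are indexed by
  a finite type \<open>'m\<close>; only the coefficient matrices, whose sizes \<open>n k\<close> may differ, are
  carrier-based.  The coefficient of index \<open>\<ell> = 0\<close> is kept apart as \<open>A0 k\<close>.

  For \<open>complex\<close> the relation \<open>0 < z\<close> means that \<open>z\<close> is real and positive.  The entry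
  \<open>(A k l *\<^sub>v u k) \<bullet>c u k\<close> is \<open>u\<^sub>k\<^sup>H A\<^sub>k\<^sub>l u\<^sub>k\<close>, since \<open>\<bullet>c\<close> conjugates its second argument.
\<close>

definition right_definite ::
  "('m::finite \<Rightarrow> nat) \<Rightarrow> ('m \<Rightarrow> 'm \<Rightarrow> complex mat) \<Rightarrow> bool" where
  "right_definite n A \<longleftrightarrow>
     (\<forall>u. (\<forall>k. u k \<in> unit_vecs (n k)) \<longrightarrow>
        0 < Determinants.det (\<chi> k l. (A k l *\<^sub>v u k) \<bullet>c u k))"

definition mep_pencil ::
  "('m::finite \<Rightarrow> nat) \<Rightarrow> ('m \<Rightarrow> complex mat) \<Rightarrow> ('m \<Rightarrow> 'm \<Rightarrow> complex mat) \<Rightarrow>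
   real ^ 'm \<Rightarrow> 'm \<Rightarrow> complex mat" where
  "mep_pencil n A0 A lam k =
     Matrix.mat (n k) (n k)
       (\<lambda>(p, q). A0 k $$ (p, q) + (\<Sum>l\<in>UNIV. complex_of_real (lam $ l) * A k l $$ (p, q)))"

text \<open>
  Eigenvalues with multiplicity are the roots of the characteristic polynomial with
  multiplicity.  The real part is only a type conversion: it is applied to Hermitian matrices,
  whose eigenvalues are real.  The position \<open>i\<close> is 1-based, \<open>1 \<le> i \<le> dim_row M\<close>.
\<close>

definition nth_largest_eigenvalue :: "nat \<Rightarrow> complex mat \<Rightarrow> real" where
  "nth_largest_eigenvalue i M =
     rev (sorted_list_of_multiset (image_mset Re (proots (char_poly M)))) ! (i - 1)"

definition mep_fun ::
  "('m::finite \<Rightarrow> nat) \<Rightarrow> ('m \<Rightarrow> complex mat) \<Rightarrow> ('m \<Rightarrow> 'm \<Rightarrow> complex mat) \<Rightarrow>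
   ('m \<Rightarrow> nat) \<Rightarrow> real ^ 'm \<Rightarrow> real ^ 'm" where
  "mep_fun n A0 A i lam = (\<chi> k. nth_largest_eigenvalue (i k) (mep_pencil n A0 A lam k))"

definition clarke_jacobian ::
  "(real ^ 'n \<Rightarrow> real ^ 'p) \<Rightarrow> real ^ 'n \<Rightarrow> (real ^ 'n ^ 'p) set" where
  "clarke_jacobian \<Phi> x =
     convex hull {L. \<exists>y. y \<longlonglongrightarrow> x \<and> (\<forall>j. \<Phi> differentiable at (y j)) \<and>
                        (\<lambda>j. jacobian \<Phi> (at (y j))) \<longlonglongrightarrow> L}"

text \<open>
  A run of \<open>N\<close> steps of the semismooth Newton method with arbitrary choices of elements of the
  generalized Jacobian; only \<open>x 0, \<dots>, x N\<close> and \<open>J 0, \<dots>, J (N - 1)\<close> are constrained.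
  The step is the linear equation itself, so solvability is not presupposed.
\<close>

definition newton_run ::
  "(real ^ 'n \<Rightarrow> real ^ 'n) \<Rightarrow> nat \<Rightarrow> (nat \<Rightarrow> real ^ 'n) \<Rightarrow> (nat \<Rightarrow> real ^ 'n ^ 'n) \<Rightarrow> bool" where
  "newton_run \<Phi> N x J \<longleftrightarrow>
     (\<forall>j<N. J j \<in> clarke_jacobian \<Phi> (x j) \<and> \<Phi> (x j) + J j *v (x (Suc j) - x j) = 0)"

end

theory Submission
  imports Defs
begin

text \<open>
  For Hermitian pencils the error of a Newton step is quadratic for a reason that involves no
  smoothness of eigenvalues.  Write \<open>P(x)\<close> for one of the matrix pencils and \<open>e(x)\<close> for its
  selected eigenvalue, let \<open>u\<close> be a unit eigenvector of \<open>P(x)\<close> for \<open>e(x)\<close>, and let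
  \<open>g = (u\<^sup>H A\<^sub>l u)\<^sub>l\<close>.  Since \<open>P\<close> is affine in \<open>x\<close>, the linearisation error
  \<open>e(x) - e(y) - g \<cdot> (x - y)\<close> equals \<open>u\<^sup>H H u\<close> with \<open>H = P(y) - e(y) I\<close>.  A Hermitian \<open>H\<close>
  satisfies \<open>|u\<^sup>H H u| \<le> \<kappa> |H u|\<^sup>2\<close> (\<open>hermitian_form_le_residual\<close>), and \<open>|H u| = O(|x - y|)\<close>
  because \<open>u\<close> is an eigenvector at \<open>x\<close> and \<open>e\<close> is Lipschitz (\<open>eigenvalue_lipschitz\<close>, a form of
  Weyl's inequality).  This is \<open>eigenvalue_quadratic_remainder\<close>.

  The same estimate identifies Clarke's generalised Jacobian well enough
  (\<open>clarke_row_in_convex_hull\<close>): every row of an element at \<open>x\<close> lies in the convex hull of the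
  vectors \<open>g\<close> that come from unit eigenvectors at \<open>x\<close>.  Otherwise a hyperplane with some normal
  \<open>d\<close> would separate the row from that hull, but the estimate along the line in direction \<open>d\<close>,
  followed by a limit, produces an eigenvector whose \<open>g\<close> has the same component along \<open>d\<close> as
  the row.

  Finally, the estimate is affine in \<open>g\<close> and the determinant is affine in each row, so both the
  quadratic estimate and the positivity of right definiteness pass to convex hulls.  Hence all
  generalised Jacobians, at all points, lie in one compact set of invertible matrices; their
  inverses are uniformly bounded, and the quadratic error bound for a Newton step holds with one
  constant everywhere.  Locality enters only through the contraction argument.  The last part
  is carried out in \<open>semismooth_newton\<close> for any map whose components have such sets of
  generalised gradients.
\<close>

section \<open>Semismooth Newton steps from set-valued gradients\<close>

text \<open>
  With the other rows fixed, positivity of the determinant is a strict linear inequality in the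
  remaining row, hence a convex condition on it, so the rows can be moved into the convex hulls one at a time.
\<close>

lemma det_pos_convex_hull_rows:
  fixes K :: "'m::finite \<Rightarrow> (real ^ 'm) set" and M :: "real ^ 'm ^ 'm"
  assumes pos: "\<And>M. (\<And>k. M $ k \<in> K k) \<Longrightarrow> 0 < Determinants.det M"
    and M: "\<And>k. M $ k \<in> convex hull (K k)"
  shows "0 < Determinants.det M"
proof -
  have "\<forall>M. (\<forall>k\<in>S. M $ k \<in> convex hull (K k)) \<and> (\<forall>k\<in>-S. M $ k \<in> K k) \<longrightarrow> 0 < Determinants.det M"
    if "finite S" for S :: "'m set"
    using that
  proof (induction S)
    case empty
    then show ?case using pos by simp
  next
    case (insert s S)
    show ?case
    proof (intro allI impI)
      fix M :: "real ^ 'm ^ 'm"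
      assume M: "(\<forall>k\<in>insert s S. M $ k \<in> convex hull (K k)) \<and> (\<forall>k\<in>-insert s S. M $ k \<in> K k)"
      define R :: "real ^ 'm \<Rightarrow> real ^ 'm ^ 'm" where "R v = (\<chi> i. if i = s then v else M $ i)" for v
      have lin: "Determinants.det (R (a *\<^sub>R x + b *\<^sub>R y)) = a * Determinants.det (R x) + b * Determinants.det (R y)" for a b x y
        using Determinants.det_row_add[of s "\<lambda>_. a *s x" "\<lambda>_. b *s y" "\<lambda>i. M $ i"]
          Determinants.det_row_mul[of s a "\<lambda>_. x" "\<lambda>i. M $ i"] Determinants.det_row_mul[of s b "\<lambda>_. y" "\<lambda>i. M $ i"]
        by (simp add: R_def flip: scalar_mult_eq_scaleR)
      have "convex {v. 0 < Determinants.det (R v)}"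
      proof (rule convexI)
        fix x y and a b :: real
        assume xy: "x \<in> {v. 0 < Determinants.det (R v)}" "y \<in> {v. 0 < Determinants.det (R v)}"
          and ab: "0 \<le> a" "0 \<le> b" "a + b = 1"
        have "0 < a * Determinants.det (R x) + b * Determinants.det (R y)"
        proof (cases "a = 0")
          case True
          then show ?thesis using xy ab by simp
        next
          case False
          then show ?thesis using xy ab by (intro add_pos_nonneg) auto
        qed
        then show "a *\<^sub>R x + b *\<^sub>R y \<in> {v. 0 < Determinants.det (R v)}" by (simp add: lin)
      qed
      moreover have "K s \<subseteq> {v. 0 < Determinants.det (R v)}"
      proof
        fix v assume v: "v \<in> K s"
        have "(\<forall>k\<in>S. R v $ k \<in> convex hull (K k)) \<and> (\<forall>k\<in>-S. R v $ k \<in> K k)"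
          using M v insert.hyps by (auto simp: R_def)
        then have "0 < Determinants.det (R v)" by (rule insert.IH[THEN spec, THEN mp])
        then show "v \<in> {v. 0 < Determinants.det (R v)}" by simp
      qed
      ultimately have "convex hull (K s) \<subseteq> {v. 0 < Determinants.det (R v)}"
        by (simp add: hull_minimal)
      then have "0 < Determinants.det (R (M $ s))" using M by auto
      moreover have "R (M $ s) = M" by (auto simp: R_def Finite_Cartesian_Product.vec_eq_iff)
      ultimately show "0 < Determinants.det M" by simp
    qed
  qed
  from this[of UNIV] M show ?thesis by simp
qed

lemma compact_rows:
  fixes S :: "'p::finite \<Rightarrow> (real ^ 'n) set"
  assumes "\<And>k. compact (S k)"
  shows "compact {M. \<forall>k. M $ k \<in> S k}"
proof -
  have eq: "{M. \<forall>k. M $ k \<in> S k} = (\<Inter>k. (\<lambda>M. M $ k) -` S k)" by auto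
  have "closed {M. \<forall>k. M $ k \<in> S k}"
    unfolding eq using assms by (intro closed_INT ballI closed_vimage_vec_nth compact_imp_closed)
  moreover have "bounded {M. \<forall>k. M $ k \<in> S k}"
  proof -
    have "\<exists>B. \<forall>v\<in>S k. norm v \<le> B" for k
      using compact_imp_bounded[OF assms] by (auto simp: bounded_iff)
    then obtain B where B: "\<And>k v. v \<in> S k \<Longrightarrow> norm v \<le> B k" by metis
    have "norm M \<le> sum B UNIV" if "\<forall>k. M $ k \<in> S k" for M
      unfolding norm_vec_def[of M] using that B
      by (intro order_trans[OF L2_set_le_sum] sum_mono) auto
    then show ?thesis unfolding bounded_iff by blast
  qed
  ultimately show ?thesis by (simp add: compact_eq_bounded_closed)
qed

lemma compact_nonsingular_lower_bound:
  fixes S :: "(real ^ 'm ^ 'm) set"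
  assumes S: "compact S" and inv: "\<And>M. M \<in> S \<Longrightarrow> invertible M"
  shows "\<exists>c>0. \<forall>M\<in>S. \<forall>v. c * norm v \<le> norm (M *v v)"
proof (cases "S = {}")
  case True
  then show ?thesis by (intro exI[of _ 1]) simp
next
  case False
  let ?f = "\<lambda>p :: (real ^ 'm ^ 'm) \<times> (real ^ 'm). norm (fst p *v snd p)"
  have "axis undefined 1 \<in> sphere (0 :: real ^ 'm) 1" by simp
  with False have ne: "S \<times> sphere (0 :: real ^ 'm) 1 \<noteq> {}" by blast
  have cpt: "compact (S \<times> sphere (0 :: real ^ 'm) 1)" using S by (intro compact_Times) auto
  have "continuous_on (S \<times> sphere 0 1) ?f"
    unfolding matrix_vector_mult_def by (intro continuous_intros)
  from continuous_attains_inf[OF cpt ne this] obtain M0 v0 where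
    M0: "M0 \<in> S" "norm v0 = 1"
    and min: "\<And>M v. M \<in> S \<Longrightarrow> norm v = 1 \<Longrightarrow> norm (M0 *v v0) \<le> norm (M *v v)"
    by (auto simp: Ball_def)
  have "M0 *v v0 \<noteq> 0"
    using inv[OF M0(1)] M0(2) matrix_left_invertible_ker[of M0] by (auto simp: invertible_def)
  then have pos: "0 < norm (M0 *v v0)" by simp
  have "norm (M0 *v v0) * norm v \<le> norm (M *v v)" if "M \<in> S" for M v
  proof (cases "v = 0")
    case True
    then show ?thesis by simp
  next
    case False
    have "norm (M0 *v v0) \<le> norm (M *v ((1 / norm v) *\<^sub>R v))"
      by (rule min) (use that False in auto)
    also have "\<dots> = norm (M *v v) / norm v"
      by (simp add: matrix_vector_mult_scaleR)
    finally show ?thesis using False by (simp add: field_simps)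
  qed
  with pos show ?thesis by blast
qed

lemma compact_closed_graph_subseq:
  fixes G :: "'a::topological_space \<Rightarrow> 'b::metric_space set"
  assumes K: "compact K" and G: "\<And>x. G x \<subseteq> K"
    and closed_graph: "\<And>x g a l. x \<longlonglongrightarrow> a \<Longrightarrow> (\<And>j. g j \<in> G (x j)) \<Longrightarrow> g \<longlonglongrightarrow> l \<Longrightarrow> l \<in> G a"
    and x: "x \<longlonglongrightarrow> a" and g: "\<And>j. g j \<in> G (x j)"
  obtains l and r :: "nat \<Rightarrow> nat" where "l \<in> G a" "strict_mono r" "(g \<circ> r) \<longlonglongrightarrow> l"
proof -
  have "\<forall>j. g j \<in> K" using g G by blast
  with K obtain l and r :: "nat \<Rightarrow> nat" where r: "strict_mono r" "(g \<circ> r) \<longlonglongrightarrow> l"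
    unfolding compact_eq_seq_compact_metric seq_compact_def by blast
  have "l \<in> G a"
    by (rule closed_graph[of "x \<circ> r" _ "g \<circ> r"]) (use x r g in \<open>auto intro: LIMSEQ_subseq_LIMSEQ\<close>)
  with r that show thesis by blast
qed

text \<open>
  The selected \<open>g\<close> may depend on the direction \<open>d\<close>: it is a limit of elements of \<open>G (y + t *\<^sub>R d)\<close> as
  \<open>t\<close> tends to \<open>0\<close> from above, and the estimate makes the difference quotients follow their
  components along \<open>d\<close>.
\<close>

lemma jacobian_row_directional:
  fixes F :: "real ^ 'n \<Rightarrow> real ^ 'p" and G :: "real ^ 'n \<Rightarrow> (real ^ 'n) set"
  assumes K: "compact K" and G: "\<And>x. G x \<subseteq> K" and ne: "\<And>x. G x \<noteq> {}"
    and closed_graph: "\<And>x g a l. x \<longlonglongrightarrow> a \<Longrightarrow> (\<And>j. g j \<in> G (x j)) \<Longrightarrow> g \<longlonglongrightarrow> l \<Longrightarrow> l \<in> G a"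
    and est: "\<And>x g. g \<in> G x \<Longrightarrow> \<bar>F x $ k - F y $ k - inner g (x - y)\<bar> \<le> C * (norm (x - y))\<^sup>2"
    and diff: "F differentiable (at y)"
  shows "\<exists>g\<in>G y. inner g d = inner (jacobian F (at y) $ k) d"
proof -
  let ?J = "jacobian F (at y)"
  define t :: "nat \<Rightarrow> real" where "t j = inverse (real (Suc j))" for j
  have t0: "t \<longlonglongrightarrow> 0" unfolding t_def by (rule LIMSEQ_inverse_real_of_nat)
  have tpos: "0 < t j" for j by (simp add: t_def)
  define x where "x j = y + t j *\<^sub>R d" for j
  have x: "x \<longlonglongrightarrow> y" unfolding x_def using t0 by (auto intro!: tendsto_eq_intros)
  have "\<forall>j. \<exists>z. z \<in> G (x j)" using ne by blast
  then obtain g where g: "\<And>j. g j \<in> G (x j)" by metis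
  obtain l and r :: "nat \<Rightarrow> nat" where l: "l \<in> G y" and r: "strict_mono r" "(g \<circ> r) \<longlonglongrightarrow> l"
    by (rule compact_closed_graph_subseq[where G = G, OF K G closed_graph x g])
  have "(F has_derivative (\<lambda>h. ?J *v h)) (at (y + 0 *\<^sub>R d))"
    using diff by (simp add: jacobian_works)
  moreover have "((\<lambda>s::real. y + s *\<^sub>R d) has_derivative (\<lambda>s. s *\<^sub>R d)) (at 0)"
    by (auto intro!: derivative_eq_intros)
  ultimately have "((\<lambda>s. F (y + s *\<^sub>R d)) has_derivative (\<lambda>s. ?J *v (s *\<^sub>R d))) (at 0)"
    using diff_chain_at[of "\<lambda>s::real. y + s *\<^sub>R d" "\<lambda>s. s *\<^sub>R d" 0 F "\<lambda>h. ?J *v h"] by (simp add: o_def)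
  then have "((\<lambda>s. F (y + s *\<^sub>R d) $ k) has_derivative (\<lambda>s. (?J *v (s *\<^sub>R d)) $ k)) (at 0)"
    by (rule bounded_linear.has_derivative[OF bounded_linear_vec_nth])
  moreover have "(\<lambda>s. (?J *v (s *\<^sub>R d)) $ k) = (*) (inner (?J $ k) d)"
    by (auto simp: matrix_vector_mult_scaleR matrix_vector_mul_component)
  ultimately have "((\<lambda>s. F (y + s *\<^sub>R d) $ k) has_field_derivative inner (?J $ k) d) (at 0)"
    by (simp add: has_field_derivative_def)
  then have "((\<lambda>s. (F (y + s *\<^sub>R d) $ k - F y $ k) / s) \<longlongrightarrow> inner (?J $ k) d) (at 0)"
    by (simp add: DERIV_def)
  moreover have "filterlim t (at 0) sequentially"
    using t0 tpos by (auto simp: filterlim_at intro!: always_eventually) (metis less_irrefl)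
  ultimately have quot: "(\<lambda>j. (F (x j) $ k - F y $ k) / t j) \<longlonglongrightarrow> inner (?J $ k) d"
    unfolding x_def by (rule filterlim_compose)
  have rem: "norm ((F (x j) $ k - F y $ k) / t j - inner (g j) d) \<le> t j * (C * (norm d)\<^sup>2)" for j
  proof -
    have "(F (x j) $ k - F y $ k) / t j - inner (g j) d
        = (F (x j) $ k - F y $ k - inner (g j) (x j - y)) / t j"
      using tpos[of j] by (simp add: x_def field_simps)
    also have "norm \<dots> = \<bar>F (x j) $ k - F y $ k - inner (g j) (x j - y)\<bar> / t j"
      using tpos[of j] by simp
    also have "\<dots> \<le> C * (norm (x j - y))\<^sup>2 / t j"
      using est[OF g[of j]] tpos[of j] by (intro divide_right_mono) auto
    also have "\<dots> = t j * (C * (norm d)\<^sup>2)"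
      using tpos[of j] by (simp add: x_def power_mult_distrib power2_eq_square)
    finally show ?thesis .
  qed
  have lim: "(\<lambda>j. t j * (C * (norm d)\<^sup>2)) \<longlonglongrightarrow> 0"
    using t0 by (auto intro!: tendsto_eq_intros)
  have "(\<lambda>j. (F (x j) $ k - F y $ k) / t j - inner (g j) d) \<longlonglongrightarrow> 0"
    by (rule Lim_null_comparison[OF always_eventually[OF allI[OF rem]] lim])
  from tendsto_diff[OF quot this] have "(\<lambda>j. inner (g j) d) \<longlonglongrightarrow> inner (?J $ k) d" by simp
  from LIMSEQ_subseq_LIMSEQ[OF this r(1)]
  have "(\<lambda>j. inner ((g \<circ> r) j) d) \<longlonglongrightarrow> inner (?J $ k) d" by (simp add: o_def)
  moreover have "(\<lambda>j. inner ((g \<circ> r) j) d) \<longlonglongrightarrow> inner l d"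
    using r(2) by (intro tendsto_intros)
  ultimately have "inner l d = inner (?J $ k) d" by (rule LIMSEQ_unique[rotated])
  with l show ?thesis by blast
qed

text \<open>
  One vector \<open>g\<close> for each direction \<open>d\<close> is enough, because a point outside a compact convex set
  is detected by a single direction.
\<close>

lemma clarke_row_in_convex_hull:
  fixes F :: "real ^ 'n \<Rightarrow> real ^ 'p" and G :: "real ^ 'n \<Rightarrow> (real ^ 'n) set"
  assumes K: "compact K" and G: "\<And>x. G x \<subseteq> K" and ne: "\<And>x. G x \<noteq> {}"
    and closed_graph: "\<And>x g a l. x \<longlonglongrightarrow> a \<Longrightarrow> (\<And>j. g j \<in> G (x j)) \<Longrightarrow> g \<longlonglongrightarrow> l \<Longrightarrow> l \<in> G a"
    and est: "\<And>y. \<exists>C. \<forall>x. \<forall>g\<in>G x. \<bar>F x $ k - F y $ k - inner g (x - y)\<bar> \<le> C * (norm (x - y))\<^sup>2"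
    and J: "J \<in> clarke_jacobian F a"
  shows "J $ k \<in> convex hull (G a)"
proof -
  have "closed (G a)"
    unfolding closed_sequential_limits using closed_graph[of "\<lambda>_. a"] by blast
  then have "compact (G a)"
    using K G[of a] by (metis Int_absorb1 compact_Int_closed)
  then have closed_hull: "closed (convex hull (G a))"
    by (intro compact_imp_closed compact_convex_hull)
  have "L $ k \<in> convex hull (G a)"
    if y: "y \<longlonglongrightarrow> a" and diff: "\<And>j. F differentiable at (y j)"
      and L: "(\<lambda>j. jacobian F (at (y j))) \<longlonglongrightarrow> L" for y L
  proof (rule ccontr)
    assume "L $ k \<notin> convex hull (G a)"
    from separating_hyperplane_closed_point[OF convex_convex_hull closed_hull this]
    obtain d b where d: "inner d (L $ k) < b" "\<And>w. w \<in> convex hull (G a) \<Longrightarrow> b < inner d w" by blast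
    have "\<exists>g\<in>G (y j). inner g d = inner (jacobian F (at (y j)) $ k) d" for j
    proof -
      from est[of "y j"] obtain C where "\<And>x g. g \<in> G x \<Longrightarrow>
          \<bar>F x $ k - F (y j) $ k - inner g (x - y j)\<bar> \<le> C * (norm (x - y j))\<^sup>2" by blast
      from jacobian_row_directional[OF K G ne closed_graph this diff] show ?thesis .
    qed
    then obtain g where g: "\<And>j. g j \<in> G (y j)"
      and gd: "\<And>j. inner (g j) d = inner (jacobian F (at (y j)) $ k) d" by metis
    \<comment> \<open>The identity along the fixed \<open>d\<close> survives the passage from the points \<open>y j\<close> to \<open>a\<close>.\<close>
    obtain l and r :: "nat \<Rightarrow> nat" where l: "l \<in> G a" and r: "strict_mono r" "(g \<circ> r) \<longlonglongrightarrow> l"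
      by (rule compact_closed_graph_subseq[where G = G, OF K G closed_graph y g])
    have "(\<lambda>j. inner (jacobian F (at (y j)) $ k) d) \<longlonglongrightarrow> inner (L $ k) d"
      using L by (intro tendsto_intros)
    from LIMSEQ_subseq_LIMSEQ[OF this r(1)]
    have "(\<lambda>j. inner ((g \<circ> r) j) d) \<longlonglongrightarrow> inner (L $ k) d" by (simp add: o_def gd)
    moreover have "(\<lambda>j. inner ((g \<circ> r) j) d) \<longlonglongrightarrow> inner l d"
      using r(2) by (intro tendsto_intros)
    ultimately have "inner l d = inner (L $ k) d" by (rule LIMSEQ_unique[rotated])
    with d(1) d(2)[OF hull_inc[OF l]] show False by (simp add: inner_commute)
  qed
  then have "{L. \<exists>y. y \<longlonglongrightarrow> a \<and> (\<forall>j. F differentiable at (y j)) \<and>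
                        (\<lambda>j. jacobian F (at (y j))) \<longlonglongrightarrow> L} \<subseteq> (\<lambda>M. M $ k) -` (convex hull (G a))"
    by auto
  moreover have "convex ((\<lambda>M :: real ^ 'n ^ 'p. M $ k) -` (convex hull (G a)))"
    by (intro convex_linear_vimage bounded_linear.linear[OF bounded_linear_vec_nth] convex_convex_hull)
  ultimately have "clarke_jacobian F a \<subseteq> (\<lambda>M. M $ k) -` (convex hull (G a))"
    unfolding clarke_jacobian_def by (rule hull_minimal)
  with J show ?thesis by auto
qed

lemma newton_error_bound:
  fixes M :: "real ^ 'm ^ 'm"
  assumes lower: "\<And>v. c * norm v \<le> norm (M *v v)" and c: "0 < c"
    and rem: "\<And>k. \<bar>F x $ k - F a $ k - inner (M $ k) (x - a)\<bar> \<le> C k * (norm (x - a))\<^sup>2"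
    and a: "F a = 0" and step: "F x + M *v (x' - x) = 0"
  shows "norm (x' - a) \<le> sum C UNIV / c * (norm (x - a))\<^sup>2"
proof -
  have "M *v (x' - a) = M *v (x' - x) + M *v (x - a)"
    by (metis add.commute diff_add_cancel diff_add_eq matrix_vector_right_distrib add_diff_eq)
  also have "\<dots> = - (F x - F a - M *v (x - a))"
    using step a by (simp add: algebra_simps eq_neg_iff_add_eq_0)
  finally have "norm (M *v (x' - a)) = norm (F x - F a - M *v (x - a))"
    by (simp only: norm_minus_cancel)
  also have "\<dots> \<le> (\<Sum>k\<in>UNIV. \<bar>(F x - F a - M *v (x - a)) $ k\<bar>)" by (rule norm_le_l1_cart)
  also have "\<dots> \<le> (\<Sum>k\<in>UNIV. C k * (norm (x - a))\<^sup>2)"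
    using rem by (intro sum_mono) (simp add: matrix_vector_mul_component)
  finally have "c * norm (x' - a) \<le> sum C UNIV * (norm (x - a))\<^sup>2"
    using lower[of "x' - a"] by (simp add: sum_distrib_right)
  then show ?thesis using c by (simp add: field_simps)
qed

text \<open>
  The radius is chosen so that \<open>C * norm (x j - a) \<le> 1 / 2\<close>, which turns the quadratic bound into
  a contraction; the summand \<open>1\<close> in the denominator covers \<open>C = 0\<close>.
\<close>

lemma quadratic_contraction:
  fixes x :: "nat \<Rightarrow> 'a::real_normed_vector"
  assumes step: "\<And>j. norm (x (Suc j) - a) \<le> C * (norm (x j - a))\<^sup>2" and C: "0 \<le> C"
    and x0: "norm (x 0 - a) \<le> 1 / (2 * C + 1)"
  shows "x \<longlonglongrightarrow> a"
proof -
  have small: "norm (x j - a) \<le> 1 / (2 * C + 1) \<and> norm (x j - a) \<le> (1/2)^j * norm (x 0 - a)" for j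
  proof (induction j)
    case 0
    then show ?case using x0 by simp
  next
    case (Suc j)
    have "norm (x (Suc j) - a) \<le> (C * norm (x j - a)) * norm (x j - a)"
      using step[of j] by (simp add: power2_eq_square mult.assoc)
    also have "\<dots> \<le> (1/2) * norm (x j - a)"
    proof (rule mult_right_mono)
      have "C * norm (x j - a) \<le> C * (1 / (2 * C + 1))"
        using Suc C by (intro mult_left_mono) auto
      also have "\<dots> \<le> 1/2" using C by (simp add: field_simps)
      finally show "C * norm (x j - a) \<le> 1/2" .
    qed simp
    finally have h: "norm (x (Suc j) - a) \<le> (1/2) * norm (x j - a)" .
    then have "norm (x (Suc j) - a) \<le> norm (x j - a)" using norm_ge_zero[of "x j - a"] by linarith
    with h Suc show ?case by simp
  qed
  have "(\<lambda>j. (1/2)^j * norm (x 0 - a)) \<longlonglongrightarrow> 0"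
    by (rule tendsto_mult_left_zero, rule LIMSEQ_power_zero) simp
  then have "(\<lambda>j. x j - a) \<longlonglongrightarrow> 0"
    by (rule Lim_null_comparison[rotated]) (use small in \<open>auto intro: always_eventually\<close>)
  then show ?thesis by (simp add: LIM_zero_iff)
qed

text \<open>
  The sets \<open>G k x\<close> play the role of generalised gradients of the \<open>k\<close>-th component.  The
  determinant condition is imposed on all of \<open>K k\<close>, not only on \<open>G k a\<close>, which makes the bound on
  the inverses independent of the point.
\<close>

theorem semismooth_newton:
  fixes F :: "real ^ 'm \<Rightarrow> real ^ 'm" and G :: "'m \<Rightarrow> real ^ 'm \<Rightarrow> (real ^ 'm) set"
  assumes K: "\<And>k. compact (K k)" and G: "\<And>k x. G k x \<subseteq> K k" and ne: "\<And>k x. G k x \<noteq> {}"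
    and closed_graph: "\<And>k x g a l. x \<longlonglongrightarrow> a \<Longrightarrow> (\<And>j. g j \<in> G k (x j)) \<Longrightarrow> g \<longlonglongrightarrow> l \<Longrightarrow> l \<in> G k a"
    and est: "\<And>k y. \<exists>C. \<forall>x. \<forall>g\<in>G k x. \<bar>F x $ k - F y $ k - inner g (x - y)\<bar> \<le> C * (norm (x - y))\<^sup>2"
    and pos: "\<And>M. (\<And>k. M $ k \<in> K k) \<Longrightarrow> 0 < Determinants.det M"
    and a: "F a = 0"
  shows "\<exists>U C. open U \<and> a \<in> U \<and>
    (\<forall>N x J M. x 0 \<in> U \<and> newton_run F N x J \<and> M \<in> clarke_jacobian F (x N) \<longrightarrow> invertible M) \<and>
    (\<forall>x J. x 0 \<in> U \<and> (\<forall>N. newton_run F N x J) \<longrightarrow>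
        x \<longlonglongrightarrow> a \<and> (\<forall>j. norm (x (Suc j) - a) \<le> C * (norm (x j - a))\<^sup>2))"
proof -
  let ?S = "{M :: real ^ 'm ^ 'm. \<forall>k. M $ k \<in> convex hull (K k)}"
  have row: "J $ k \<in> convex hull (G k x)" if "J \<in> clarke_jacobian F x" for J k x
    by (rule clarke_row_in_convex_hull[OF K G ne closed_graph est that])
  have S: "J \<in> ?S" if "J \<in> clarke_jacobian F x" for J x
    using row[OF that] hull_mono[OF G] by blast
  have inv: "invertible M" if "M \<in> ?S" for M
    using det_pos_convex_hull_rows[where K = K, OF pos, of M] that by (simp add: invertible_det_nz)
  have "compact ?S" using K by (intro compact_rows compact_convex_hull)
  from compact_nonsingular_lower_bound[OF this inv] obtain c where
    c: "0 < c" and lower: "\<And>M v. M \<in> ?S \<Longrightarrow> c * norm v \<le> norm (M *v v)" by blast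
  have "\<forall>k. \<exists>C. \<forall>x. \<forall>g\<in>G k x. \<bar>F x $ k - F a $ k - inner g (x - a)\<bar> \<le> C * (norm (x - a))\<^sup>2"
    using est by blast
  then obtain C0 where C0: "\<And>k x g. g \<in> G k x \<Longrightarrow>
      \<bar>F x $ k - F a $ k - inner g (x - a)\<bar> \<le> C0 k * (norm (x - a))\<^sup>2" by metis
  define C where "C k = \<bar>C0 k\<bar>" for k
  have C: "\<bar>F x $ k - F a $ k - inner g (x - a)\<bar> \<le> C k * (norm (x - a))\<^sup>2"
    if "g \<in> convex hull (G k x)" for g k x
  proof -
    let ?R = "C k * (norm (x - a))\<^sup>2" and ?v = "F x $ k - F a $ k"
    let ?H = "{g. inner (x - a) g \<le> ?v + ?R} \<inter> {g. inner (x - a) g \<ge> ?v - ?R}"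
    have "C0 k * (norm (x - a))\<^sup>2 \<le> ?R" by (simp add: C_def mult_right_mono)
    then have "\<bar>F x $ k - F a $ k - inner g (x - a)\<bar> \<le> ?R" if "g \<in> G k x" for g
      using C0[OF that] by linarith
    then have "G k x \<subseteq> ?H" by (auto simp: inner_commute abs_le_iff) (smt (verit))+
    then have "convex hull (G k x) \<subseteq> ?H"
      by (intro hull_minimal convex_Int convex_halfspace_le convex_halfspace_ge)
    with that have "g \<in> ?H" by blast
    then show ?thesis by (auto simp: inner_commute abs_le_iff)
  qed
  define C' where "C' = sum C UNIV / c"
  have C'0: "0 \<le> C'" using c by (auto simp: C'_def C_def intro!: divide_nonneg_pos sum_nonneg)
  have step: "norm (x (Suc j) - a) \<le> C' * (norm (x j - a))\<^sup>2"
    if "newton_run F (Suc j) x J" for x J j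
  proof -
    from that have J: "J j \<in> clarke_jacobian F (x j)" and st: "F (x j) + J j *v (x (Suc j) - x j) = 0"
      by (auto simp: newton_run_def)
    show ?thesis unfolding C'_def
      by (rule newton_error_bound[OF lower[OF S[OF J]] c C[OF row[OF J]] a st])
  qed
  let ?U = "ball a (1 / (2 * C' + 1))"
  have "open ?U" "a \<in> ?U" using C'0 by auto
  moreover have "invertible M" if "M \<in> clarke_jacobian F y" for M y
    using inv S[OF that] by blast
  moreover have "x \<longlonglongrightarrow> a \<and> (\<forall>j. norm (x (Suc j) - a) \<le> C' * (norm (x j - a))\<^sup>2)"
    if x0: "x 0 \<in> ?U" and run: "\<forall>N. newton_run F N x J" for x J
  proof -
    have st: "norm (x (Suc j) - a) \<le> C' * (norm (x j - a))\<^sup>2" for j using step run by blast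
    have "norm (x 0 - a) \<le> 1 / (2 * C' + 1)" using x0 by (simp add: dist_norm norm_minus_commute)
    from quadratic_contraction[OF st C'0 this] st show ?thesis by blast
  qed
  ultimately show ?thesis
    by (intro exI[of _ ?U] exI[of _ C'] conjI allI impI) blast+
qed

section \<open>Unitary diagonalisation of Hermitian matrices\<close>

notation vec_index (infixl "$v" 100)

lemma mat_adjoint_dim [simp]:
  "dim_row (mat_adjoint M) = dim_col M" "dim_col (mat_adjoint M) = dim_row M"
  by (simp_all add: mat_adjoint_def)

lemma mat_adjoint_carrier [simp]: "M \<in> carrier_mat n m \<Longrightarrow> mat_adjoint M \<in> carrier_mat m n"
  unfolding carrier_mat_def by simp

lemma mat_adjoint_index [simp]:
  "p < dim_col M \<Longrightarrow> q < dim_row M \<Longrightarrow> mat_adjoint M $$ (p, q) = conjugate (M $$ (q, p))"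
  by (simp add: mat_adjoint_def mat_of_rows_index)

lemma mat_adjoint_adjoint [simp]: "mat_adjoint (mat_adjoint M) = M"
  by (rule eq_matI) auto

lemma mat_adjoint_mult:
  fixes M N :: "complex mat"
  assumes "M \<in> carrier_mat a b" "N \<in> carrier_mat b c"
  shows "mat_adjoint (M * N) = mat_adjoint N * mat_adjoint M"
  using assms by (intro eq_matI) (auto simp: scalar_prod_def mult.commute)

lemma mult_mat_vec_cscalar_adjoint:
  fixes M :: "complex mat"
  assumes M: "M \<in> carrier_mat a b" and u: "u \<in> carrier_vec b" and w: "w \<in> carrier_vec a"
  shows "(M *\<^sub>v u) \<bullet>c w = u \<bullet>c (mat_adjoint M *\<^sub>v w)"
proof -
  have "(M *\<^sub>v u) \<bullet>c w = (\<Sum>p<a. \<Sum>q<b. M $$ (p, q) * u $v q * cnj (w $v p))"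
    using M u w by (auto simp: scalar_prod_def sum_distrib_right lessThan_atLeast0 intro!: sum.cong)
  also have "\<dots> = (\<Sum>q<b. \<Sum>p<a. M $$ (p, q) * u $v q * cnj (w $v p))" by (rule sum.swap)
  also have "\<dots> = u \<bullet>c (mat_adjoint M *\<^sub>v w)"
    using M u w by (auto simp: scalar_prod_def sum_distrib_left lessThan_atLeast0 ac_simps intro!: sum.cong)
  finally show ?thesis .
qed

lemma cscalar_self: "u \<bullet>c u = complex_of_real (\<Sum>p<dim_vec u. (cmod (u $v p))\<^sup>2)"
  by (simp add: scalar_prod_def lessThan_atLeast0 complex_norm_square del: of_real_power)

lemma hermitian_form_real:
  assumes M: "M \<in> carrier_mat n n" "hermitian_mat M" and u: "u \<in> carrier_vec n"
  shows "(M *\<^sub>v u) \<bullet>c u = complex_of_real (Re ((M *\<^sub>v u) \<bullet>c u))"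
proof -
  have "(M *\<^sub>v u) \<bullet>c u = u \<bullet>c (M *\<^sub>v u)"
    using mult_mat_vec_cscalar_adjoint[OF M(1) u u] M(2) by (simp add: hermitian_mat_def)
  also have "\<dots> = cnj ((M *\<^sub>v u) \<bullet>c u)"
    using M u by (simp add: scalar_prod_def mult.commute)
  finally have "(M *\<^sub>v u) \<bullet>c u \<in> \<real>" by (simp add: Reals_cnj_iff)
  then show ?thesis by simp
qed

lemma hermitian_eigenvalue_real:
  assumes M: "M \<in> carrier_mat n n" "hermitian_mat M" and e: "eigenvalue M e"
  shows "e = complex_of_real (Re e)"
proof -
  from e obtain v where v: "v \<in> carrier_vec n" "v \<noteq> 0\<^sub>v n" "M *\<^sub>v v = e \<cdot>\<^sub>v v"
    using M by (auto simp: eigenvalue_def eigenvector_def)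
  have "e * (v \<bullet>c v) \<in> \<real>"
  proof -
    have "(M *\<^sub>v v) \<bullet>c v \<in> \<real>"
      by (subst hermitian_form_real[OF M v(1)]) simp
    then show ?thesis using v by simp
  qed
  moreover have "v \<bullet>c v \<in> \<real>" by (simp add: cscalar_self)
  ultimately have "e * (v \<bullet>c v) / (v \<bullet>c v) \<in> \<real>" by (rule Reals_divide)
  then show ?thesis using v by simp
qed

text \<open>
  Gram-Schmidt produces pairwise orthogonal columns only; the factor \<open>s\<close> arises from normalising
  them.
\<close>

lemma unitary_completion:
  fixes v :: "complex Matrix.vec"
  assumes v: "v \<in> carrier_vec n" "v \<noteq> 0\<^sub>v n"
  obtains W and s :: complex where "W \<in> carrier_mat n n" "mat_adjoint W * W = 1\<^sub>m n" "col W 0 = s \<cdot>\<^sub>v v"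
proof -
  interpret cof_vec_space n "TYPE(complex)" .
  have n: "0 < n" using v by (cases n) auto
  define ws where "ws = gram_schmidt n (basis_completion v)"
  note bc = basis_completion[OF v]
  from bc(7) obtain vs where bv: "basis_completion v = v # vs"
    using bc(6) n by (cases "basis_completion v") auto
  note gs = gram_schmidt_result[OF bc(2,4,5) ws_def]
  have hd: "ws ! 0 = v"
    using gram_schmidt_hd[OF v(1), of vs] gs(4) bc(6) n
    by (cases ws) (auto simp: ws_def bv)
  have len: "length ws = n" using gs(4) bc(6) by simp
  have wsc: "ws ! p \<in> carrier_vec n" if "p < n" for p using gs(3) len that by auto
  define s where "s w = complex_of_real (1 / sqrt (Re (w \<bullet>c w)))" for w :: "complex Matrix.vec"
  define W where "W = mat_of_cols n (map (\<lambda>w. s w \<cdot>\<^sub>v w) ws)"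
  have W: "W \<in> carrier_mat n n" by (rule carrier_matI) (simp_all add: W_def len)
  have colW: "col W p = s (ws ! p) \<cdot>\<^sub>v (ws ! p)" if "p < n" for p
    using that len wsc by (simp add: W_def)
  have "mat_adjoint W * W = 1\<^sub>m n"
  proof (rule eq_matI)
    fix p q assume "p < dim_row (1\<^sub>m n :: complex mat)" "q < dim_col (1\<^sub>m n :: complex mat)"
    then have p: "p < n" and q: "q < n" by auto
    have "(mat_adjoint W * W) $$ (p, q) = col W q \<bullet>c col W p"
      using W p q by (simp add: scalar_prod_def mult.commute)
    also have "\<dots> = s (ws ! q) * cnj (s (ws ! p)) * (ws ! q \<bullet>c ws ! p)"
      using wsc[OF p] wsc[OF q] by (simp add: colW p q conjugate_smult_vec)
    also have "\<dots> = (if p = q then 1 else 0)"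
    proof (cases "p = q")
      case True
      have "ws ! p \<bullet>c ws ! p \<noteq> 0" using corthogonalD[OF gs(2), of p p] p len by simp
      then have "Re (ws ! p \<bullet>c ws ! p) > 0"
        by (auto simp: cscalar_self less_le sum_nonneg simp del: of_real_sum of_real_power)
      then have "s (ws ! p) * cnj (s (ws ! p)) * complex_of_real (Re (ws ! p \<bullet>c ws ! p)) = 1"
        unfolding s_def by (simp flip: of_real_mult add: field_simps)
      moreover have "complex_of_real (Re (ws ! p \<bullet>c ws ! p)) = ws ! p \<bullet>c ws ! p"
        by (simp add: cscalar_self)
      ultimately show ?thesis using True by simp
    next
      case False
      then show ?thesis using corthogonalD[OF gs(2), of q p] p q len by simp
    qed
    finally show "(mat_adjoint W * W) $$ (p, q) = 1\<^sub>m n $$ (p, q)" using p q by simp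
  qed (use W in auto)
  with W colW[OF n] hd show thesis using that by auto
qed

definition diag_matrix :: "complex list \<Rightarrow> complex mat" where
  "diag_matrix es = Matrix.mat (length es) (length es) (\<lambda>(p, q). if p = q then es ! p else 0)"

text \<open>
  The list \<open>es\<close> of eigenvalues may be given in any order, so that a sorted list can be inserted
  later.  As in the Schur decomposition, one eigenvector is split off at a time; since the
  conjugated matrix is again Hermitian, its first row vanishes together with its first column.
\<close>

lemma hermitian_unitary_diagonalization:
  assumes "M \<in> carrier_mat n n" "hermitian_mat M" "char_poly M = (\<Prod>e\<leftarrow>es. [:- e, 1:])"
  shows "length es = n \<and>
    (\<exists>U\<in>carrier_mat n n. mat_adjoint U * U = 1\<^sub>m n \<and> mat_adjoint U * M * U = diag_matrix es)"
  using assms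
proof (induction es arbitrary: n M)
  case Nil
  from degree_monic_char_poly[OF Nil(1)] Nil(3) have n: "n = 0" by simp
  have "\<exists>U\<in>carrier_mat n n. mat_adjoint U * U = 1\<^sub>m n \<and> mat_adjoint U * M * U = diag_matrix []"
    using Nil(1) n by (intro bexI[of _ "1\<^sub>m 0"] conjI eq_matI) (auto simp: diag_matrix_def)
  then show ?case using n by simp
next
  case (Cons e es n M)
  note M = Cons.prems(1) and herm = Cons.prems(2)
  have cp: "char_poly M = [:- e, 1:] * (\<Prod>e\<leftarrow>es. [:- e, 1:])" using Cons.prems(3) by simp
  then have "eigenvalue M e" by (simp add: eigenvalue_root_char_poly[OF M])
  then obtain v where v: "v \<in> carrier_vec n" "v \<noteq> 0\<^sub>v n" "M *\<^sub>v v = e \<cdot>\<^sub>v v"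
    using M by (auto simp: eigenvalue_def eigenvector_def)
  then obtain N where n: "n = Suc N" by (cases n) auto
  obtain W s where W: "W \<in> carrier_mat n n" and WW: "mat_adjoint W * W = 1\<^sub>m n"
    and col0: "col W 0 = s \<cdot>\<^sub>v v" by (rule unitary_completion[OF v(1,2)])
  have WH: "mat_adjoint W \<in> carrier_mat n n" using W by simp
  have WW': "W * mat_adjoint W = 1\<^sub>m n" by (rule mat_mult_left_right_inverse[OF WH W WW])
  define M' where "M' = mat_adjoint W * (M * W)"
  have MW: "M * W \<in> carrier_mat n n" using M W by simp
  have M': "M' \<in> carrier_mat n n" unfolding M'_def using WH MW by simp
  have herm': "mat_adjoint M' = M'"
    using herm M W WH MW by (simp add: M'_def hermitian_mat_def mat_adjoint_mult[OF WH MW]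
        mat_adjoint_mult[OF M W] assoc_mult_mat[OF WH M W])
  have "col M' 0 = mat_adjoint W *\<^sub>v (M *\<^sub>v col W 0)"
    unfolding M'_def using n by (simp add: col_mult2[OF WH MW] col_mult2[OF M W])
  also have "\<dots> = e \<cdot>\<^sub>v (mat_adjoint W *\<^sub>v col W 0)"
    using v M WH by (simp add: col0 mult_mat_vec smult_smult_assoc mult.commute)
  also have "mat_adjoint W *\<^sub>v col W 0 = col (1\<^sub>m n) 0"
    using col_mult2[OF WH W, of 0] n by (simp add: WW)
  finally have c0: "col M' 0 = e \<cdot>\<^sub>v unit_vec n 0" using n by simp
  have first_col: "M' $$ (p, 0) = (if p = 0 then e else 0)" if "p < n" for p
    using arg_cong[OF c0, of "\<lambda>w. w $v p"] that M' n by simp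
  have first_row: "M' $$ (0, p) = (if p = 0 then e else 0)" if "p < n" for p
  proof -
    have "M' $$ (0, p) = mat_adjoint M' $$ (0, p)" by (simp add: herm')
    also have "\<dots> = cnj (M' $$ (p, 0))" using M' that n by simp
    finally show ?thesis using first_col[OF that] first_col[of 0] n by (auto split: if_splits)
  qed
  define M3 where "M3 = Matrix.mat N N (\<lambda>(p, q). M' $$ (Suc p, Suc q))"
  define E where "E = Matrix.mat 1 1 (\<lambda>_ :: nat \<times> nat. e)"
  have M3: "M3 \<in> carrier_mat N N" and E: "E \<in> carrier_mat 1 1" by (simp_all add: M3_def E_def)
  have block: "M' = four_block_mat E (0\<^sub>m 1 N) (0\<^sub>m N 1) M3"
    by (rule eq_matI)
      (use M' n first_row first_col in \<open>auto simp: M3_def E_def\<close>)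
  have "hermitian_mat M3"
    unfolding hermitian_mat_def
  proof (rule eq_matI)
    fix p q assume "p < dim_row M3" "q < dim_col M3"
    then have pq: "p < N" "q < N" using M3 by auto
    have "cnj (M' $$ (Suc q, Suc p)) = mat_adjoint M' $$ (Suc p, Suc q)" using M' pq n by simp
    then show "mat_adjoint M3 $$ (p, q) = M3 $$ (p, q)" using pq by (simp add: M3_def herm')
  qed (use M3 in auto)
  moreover have "char_poly M3 = (\<Prod>e\<leftarrow>es. [:- e, 1:])"
  proof -
    have "M' = mat_adjoint W * M * W" by (simp add: M'_def assoc_mult_mat[OF WH M W])
    moreover have "{M', M, mat_adjoint W, W} \<subseteq> carrier_mat n n" using M' M WH W by blast
    ultimately have "similar_mat M' M" using WW WW' by (metis similar_matI)
    then have "char_poly M = char_poly M'" by (simp add: char_poly_similar)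
    also have "\<dots> = char_poly E * char_poly M3"
      unfolding block by (rule char_poly_four_block_zeros_col) (use E M3 in auto)
    also have "char_poly E = [:- e, 1:]"
      by (simp add: E_def char_poly_defs Determinant.det_def sign_def)
    finally show ?thesis using cp by (metis mult_cancel_left pCons_eq_0_iff zero_neq_one)
  qed
  ultimately obtain U where len: "length es = N" and U: "U \<in> carrier_mat N N"
    and UU: "mat_adjoint U * U = 1\<^sub>m N" and UMU: "mat_adjoint U * M3 * U = diag_matrix es"
    using Cons.IH[OF M3] by blast
  define Q where "Q = four_block_mat (1\<^sub>m 1) (0\<^sub>m 1 N) (0\<^sub>m N 1) U"
  have Q: "Q \<in> carrier_mat n n" using U n by (intro carrier_matI) (auto simp: Q_def)
  have UH: "mat_adjoint U \<in> carrier_mat N N" using U by simp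
  have QH: "mat_adjoint Q = four_block_mat (1\<^sub>m 1) (0\<^sub>m 1 N) (0\<^sub>m N 1) (mat_adjoint U)"
    by (rule eq_matI) (use U in \<open>auto simp: Q_def\<close>)
  have QHc: "mat_adjoint Q \<in> carrier_mat n n" using Q by simp
  have QQ: "mat_adjoint Q * Q = 1\<^sub>m n"
    unfolding QH unfolding Q_def using U UH n
    by (subst mult_four_block_mat[of _ 1 1 _ N _ N]) (auto simp: UU)
  have QMQ: "mat_adjoint Q * (M' * Q) = diag_matrix (e # es)"
  proof -
    have "M' * Q = four_block_mat E (0\<^sub>m 1 N) (0\<^sub>m N 1) (M3 * U)"
      unfolding block Q_def using U M3 E
      by (subst mult_four_block_mat[of _ 1 1 _ N _ N]) auto
    then have "mat_adjoint Q * (M' * Q) = four_block_mat E (0\<^sub>m 1 N) (0\<^sub>m N 1) (mat_adjoint U * (M3 * U))"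
      unfolding QH using UH U M3 E
      by (simp, subst mult_four_block_mat[of _ 1 1 _ N _ N]) auto
    also have "\<dots> = four_block_mat E (0\<^sub>m 1 N) (0\<^sub>m N 1) (diag_matrix es)"
      using UMU by (simp add: assoc_mult_mat[OF UH M3 U])
    also have "\<dots> = diag_matrix (e # es)"
      by (rule eq_matI) (auto simp: diag_matrix_def E_def nth_Cons' len)
    finally show ?thesis .
  qed
  have WQ: "W * Q \<in> carrier_mat n n" using W Q by simp
  have adj: "mat_adjoint (W * Q) = mat_adjoint Q * mat_adjoint W" by (rule mat_adjoint_mult[OF W Q])
  have "mat_adjoint (W * Q) * (W * Q) = mat_adjoint Q * ((mat_adjoint W * W) * Q)"
    using W Q WH QHc by (simp add: adj assoc_mult_mat[of _ n n _ n _ n])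
  also have "\<dots> = 1\<^sub>m n" using Q by (simp add: WW QQ)
  finally have 1: "mat_adjoint (W * Q) * (W * Q) = 1\<^sub>m n" .
  have MWQ: "M * (W * Q) \<in> carrier_mat n n" and QW: "mat_adjoint Q * mat_adjoint W \<in> carrier_mat n n"
    using M WQ WH QHc by simp_all
  have "mat_adjoint (W * Q) * M * (W * Q) = mat_adjoint Q * (mat_adjoint W * (M * (W * Q)))"
    unfolding adj assoc_mult_mat[OF QW M WQ] by (rule assoc_mult_mat[OF QHc WH MWQ])
  also have "mat_adjoint W * (M * (W * Q)) = M' * Q"
    unfolding M'_def assoc_mult_mat[OF WH MW Q] assoc_mult_mat[OF M W Q] ..
  finally have 2: "mat_adjoint (W * Q) * M * (W * Q) = diag_matrix (e # es)" by (simp add: QMQ)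
  show ?case using 1 2 WQ len n by auto
qed

lemma proots_linear_factors: "proots (\<Prod>e\<leftarrow>es. [:- e, 1:]) = mset (es :: complex list)"
proof (induction es)
  case (Cons e es)
  have "(\<Prod>e\<leftarrow>es. [:- e, 1:]) \<noteq> 0" by (auto simp: prod_list_zero_iff)
  then have "proots ([:- e, 1:] * (\<Prod>e\<leftarrow>es. [:- e, 1:])) = proots [:- e, 1:] + proots (\<Prod>e\<leftarrow>es. [:- e, 1:])"
    by (intro proots_mult) auto
  with Cons show ?case by simp
qed simp

text \<open>
  The eigenvalues \<open>\<mu>\<close> are indexed from \<open>0\<close> in descending order, so \<open>\<mu> (i - 1)\<close> is the \<open>i\<close>-th largest.
\<close>

lemma hermitian_spectral:
  assumes M: "M \<in> carrier_mat n n" "hermitian_mat M"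
  obtains U and \<mu> :: "nat \<Rightarrow> real" where "U \<in> carrier_mat n n" "mat_adjoint U * U = 1\<^sub>m n"
    "mat_adjoint U * M * U = diag_matrix (map (\<lambda>j. complex_of_real (\<mu> j)) [0..<n])"
    "\<And>p q. p \<le> q \<Longrightarrow> q < n \<Longrightarrow> \<mu> q \<le> \<mu> p"
    "\<And>i. 1 \<le> i \<Longrightarrow> i \<le> n \<Longrightarrow> nth_largest_eigenvalue i M = \<mu> (i - 1)"
proof -
  obtain as where as: "char_poly M = (\<Prod>a\<leftarrow>as. [:- a, 1:])"
    using char_poly_factorized[OF M(1)] by blast
  have real: "complex_of_real (Re a) = a" if "a \<in> set as" for a
  proof -
    have "poly (\<Prod>a\<leftarrow>as. [:- a, 1:]) a = 0" using that by (induction as) auto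
    then have "eigenvalue M a" by (simp add: eigenvalue_root_char_poly[OF M(1)] as)
    from hermitian_eigenvalue_real[OF M this] show ?thesis by simp
  qed
  define rs where "rs = rev (sorted_list_of_multiset (image_mset Re (mset as)))"
  have "mset (map complex_of_real rs) = image_mset (\<lambda>a. complex_of_real (Re a)) (mset as)"
    by (simp add: rs_def multiset.map_comp o_def)
  also have "\<dots> = image_mset (\<lambda>a. a) (mset as)" by (rule image_mset_cong) (use real in auto)
  finally have ms: "mset (map complex_of_real rs) = mset as" by simp
  have prod: "(\<Prod>e\<leftarrow>es. [:- e, 1:]) = prod_mset (image_mset (\<lambda>e. [:- e, 1:]) (mset es))"
    for es :: "complex list" by (simp flip: prod_mset_prod_list)
  have "char_poly M = (\<Prod>e\<leftarrow>map complex_of_real rs. [:- e, 1:])"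
    unfolding as prod ms ..
  from hermitian_unitary_diagonalization[OF M this]
  obtain U where len: "length rs = n" and U: "U \<in> carrier_mat n n" "mat_adjoint U * U = 1\<^sub>m n"
      "mat_adjoint U * M * U = diag_matrix (map complex_of_real rs)" by auto
  show thesis
  proof (rule that[of U "\<lambda>j. rs ! j"])
    show "mat_adjoint U * M * U = diag_matrix (map (\<lambda>j. complex_of_real (rs ! j)) [0..<n])"
    proof -
      have "map complex_of_real rs = map (\<lambda>j. complex_of_real (rs ! j)) [0..<n]"
        by (rule nth_equalityI) (auto simp: len)
      then show ?thesis using U(3) by simp
    qed
    show "rs ! q \<le> rs ! p" if "p \<le> q" "q < n" for p q
    proof -
      have "sorted (rev rs)" by (simp add: rs_def)
      then show ?thesis using that len by (simp add: sorted_rev_nth_mono)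
    qed
    show "nth_largest_eigenvalue i M = rs ! (i - 1)" if "1 \<le> i" "i \<le> n" for i
      by (simp add: nth_largest_eigenvalue_def as proots_linear_factors rs_def)
  qed (use U in auto)
qed

lemma unitary_right_inverse:
  fixes U :: "complex mat"
  assumes "U \<in> carrier_mat n n" "mat_adjoint U * U = 1\<^sub>m n"
  shows "U * mat_adjoint U = 1\<^sub>m n"
  by (rule mat_mult_left_right_inverse[OF mat_adjoint_carrier[OF assms(1)] assms])

lemma unitary_cscalar:
  fixes U :: "complex mat"
  assumes U: "U \<in> carrier_mat n n" "mat_adjoint U * U = 1\<^sub>m n"
    and u: "u \<in> carrier_vec n" and w: "w \<in> carrier_vec n"
  shows "(U *\<^sub>v u) \<bullet>c (U *\<^sub>v w) = u \<bullet>c w"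
proof -
  have UH: "mat_adjoint U \<in> carrier_mat n n" using U(1) by simp
  have "(U *\<^sub>v u) \<bullet>c (U *\<^sub>v w) = u \<bullet>c (mat_adjoint U *\<^sub>v (U *\<^sub>v w))"
    by (rule mult_mat_vec_cscalar_adjoint) (use U u w in auto)
  also have "mat_adjoint U *\<^sub>v (U *\<^sub>v w) = w"
    using U(2) w assoc_mult_mat_vec[OF UH U(1) w] by simp
  finally show ?thesis .
qed

lemma diag_matrix_mult_vec:
  assumes "c \<in> carrier_vec n"
  shows "diag_matrix (map f [0..<n]) *\<^sub>v c = Matrix.vec n (\<lambda>j. f j * c $v j)"
  using assms
  by (intro eq_vecI) (auto simp: diag_matrix_def scalar_prod_def if_distrib[of "\<lambda>z. z * _"] sum.delta cong: if_cong)

lemma unitary_diagonal_apply: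
  fixes U :: "complex mat"
  assumes U: "U \<in> carrier_mat n n" "mat_adjoint U * U = 1\<^sub>m n" and M: "M \<in> carrier_mat n n"
    and D: "mat_adjoint U * M * U = diag_matrix (map f [0..<n])"
    and c: "c \<in> carrier_vec n"
  shows "M *\<^sub>v (U *\<^sub>v c) = U *\<^sub>v Matrix.vec n (\<lambda>j. f j * c $v j)"
proof -
  have UH: "mat_adjoint U \<in> carrier_mat n n" using U(1) by simp
  have UM: "mat_adjoint U * M \<in> carrier_mat n n" using UH M by simp
  have w: "M *\<^sub>v (U *\<^sub>v c) \<in> carrier_vec n" using M U c by simp
  have Uc: "U *\<^sub>v c \<in> carrier_vec n" using U c by simp
  have "M *\<^sub>v (U *\<^sub>v c) = (U * mat_adjoint U) *\<^sub>v (M *\<^sub>v (U *\<^sub>v c))"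
    using w by (simp add: unitary_right_inverse[OF U])
  also have "\<dots> = U *\<^sub>v (mat_adjoint U *\<^sub>v (M *\<^sub>v (U *\<^sub>v c)))"
    by (rule assoc_mult_mat_vec[OF U(1) UH w])
  also have "mat_adjoint U *\<^sub>v (M *\<^sub>v (U *\<^sub>v c)) = (mat_adjoint U * M * U) *\<^sub>v c"
    using assoc_mult_mat_vec[OF UM U(1) c] assoc_mult_mat_vec[OF UH M Uc] by simp
  also have "\<dots> = Matrix.vec n (\<lambda>j. f j * c $v j)"
    unfolding D by (rule diag_matrix_mult_vec[OF c])
  finally show ?thesis .
qed

section \<open>Residuals and perturbation of eigenvalues\<close>

definition vnorm2 :: "complex Matrix.vec \<Rightarrow> real" where
  "vnorm2 u = (\<Sum>p<dim_vec u. (cmod (u $v p))\<^sup>2)"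

definition qform :: "complex mat \<Rightarrow> complex Matrix.vec \<Rightarrow> real" where
  "qform M u = Re ((M *\<^sub>v u) \<bullet>c u)"

lemma cscalar_self_vnorm2: "u \<bullet>c u = complex_of_real (vnorm2 u)"
  by (simp only: cscalar_self vnorm2_def)

lemma unit_vecs_vnorm2: "u \<in> unit_vecs n \<longleftrightarrow> u \<in> carrier_vec n \<and> vnorm2 u = 1"
  unfolding unit_vecs_def by (simp add: cscalar_self_vnorm2)

lemma vnorm2_nonneg: "0 \<le> vnorm2 u" by (simp add: vnorm2_def sum_nonneg)

lemma vnorm2_smult: "vnorm2 (a \<cdot>\<^sub>v u) = (cmod a)\<^sup>2 * vnorm2 u"
  by (simp add: vnorm2_def norm_mult power_mult_distrib sum_distrib_left)

lemma vnorm2_unitary: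
  assumes "U \<in> carrier_mat n n" "mat_adjoint U * U = 1\<^sub>m n" "c \<in> carrier_vec n"
  shows "vnorm2 (U *\<^sub>v c) = vnorm2 c"
  using unitary_cscalar[OF assms(1,2,3,3)] by (simp add: cscalar_self_vnorm2)

lemma qform_diagonal:
  fixes U :: "complex mat" and \<mu> :: "nat \<Rightarrow> real"
  assumes U: "U \<in> carrier_mat n n" "mat_adjoint U * U = 1\<^sub>m n" and M: "M \<in> carrier_mat n n"
    and D: "mat_adjoint U * M * U = diag_matrix (map (\<lambda>j. complex_of_real (\<mu> j)) [0..<n])"
    and c: "c \<in> carrier_vec n"
  shows "qform M (U *\<^sub>v c) = (\<Sum>j<n. \<mu> j * (cmod (c $v j))\<^sup>2)"
    and "vnorm2 (M *\<^sub>v (U *\<^sub>v c)) = (\<Sum>j<n. (\<mu> j)\<^sup>2 * (cmod (c $v j))\<^sup>2)"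
proof -
  let ?d = "Matrix.vec n (\<lambda>j. complex_of_real (\<mu> j) * c $v j)"
  note app = unitary_diagonal_apply[OF U M D c]
  have "qform M (U *\<^sub>v c) = Re (?d \<bullet>c c)"
    unfolding qform_def app using unitary_cscalar[OF U _ c] by simp
  also have "?d \<bullet>c c = (\<Sum>j<n. complex_of_real (\<mu> j * (cmod (c $v j))\<^sup>2))"
    using c by (auto simp: scalar_prod_def lessThan_atLeast0 complex_norm_square mult.assoc simp del: of_real_power intro!: sum.cong)
  finally show "qform M (U *\<^sub>v c) = (\<Sum>j<n. \<mu> j * (cmod (c $v j))\<^sup>2)"
    by (simp only: Re_complex_of_real flip: of_real_sum)
  show "vnorm2 (M *\<^sub>v (U *\<^sub>v c)) = (\<Sum>j<n. (\<mu> j)\<^sup>2 * (cmod (c $v j))\<^sup>2)"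
    unfolding app using vnorm2_unitary[OF U, of ?d]
    by (simp add: vnorm2_def norm_mult power_mult_distrib)
qed

lemma unitary_coordinates:
  fixes U :: "complex mat"
  assumes U: "U \<in> carrier_mat n n" "mat_adjoint U * U = 1\<^sub>m n" and u: "u \<in> carrier_vec n"
  shows "U *\<^sub>v (mat_adjoint U *\<^sub>v u) = u"
proof -
  have UH: "mat_adjoint U \<in> carrier_mat n n" using U(1) by simp
  show ?thesis using assoc_mult_mat_vec[OF U(1) UH u] u by (simp add: unitary_right_inverse[OF U])
qed

text \<open>
  In an orthonormal eigenbasis both sides are weighted sums of the same squares, with weights
  \<open>\<mu> j\<close> and \<open>(\<mu> j)\<^sup>2\<close>; the constant \<open>\<kappa>\<close> compares them, and zero eigenvalues contribute nothing to
  either side.  This quadratic gain over the Cauchy-Schwarz inequality is the source of the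
  quadratic convergence.
\<close>

lemma hermitian_form_le_residual:
  assumes M: "M \<in> carrier_mat n n" "hermitian_mat M"
  shows "\<exists>\<kappa>\<ge>0. \<forall>u\<in>carrier_vec n. \<bar>qform M u\<bar> \<le> \<kappa> * vnorm2 (M *\<^sub>v u)"
proof -
  obtain U \<mu> where U: "U \<in> carrier_mat n n" "mat_adjoint U * U = 1\<^sub>m n"
    and D: "mat_adjoint U * M * U = diag_matrix (map (\<lambda>j. complex_of_real (\<mu> j)) [0..<n])"
    by (rule hermitian_spectral[OF M])
  \<comment> \<open>Zero eigenvalues add \<open>1 / 0 = 0\<close>.\<close>
  define \<kappa> where "\<kappa> = (\<Sum>j<n. 1 / \<bar>\<mu> j\<bar>)"
  have \<kappa>: "0 \<le> \<kappa>" by (simp add: \<kappa>_def sum_nonneg)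
  have bd: "\<bar>\<mu> j\<bar> \<le> \<kappa> * (\<mu> j)\<^sup>2" if "j < n" for j
  proof (cases "\<mu> j = 0")
    case False
    have "1 / \<bar>\<mu> j\<bar> \<le> \<kappa>" unfolding \<kappa>_def using that by (intro member_le_sum) auto
    then have "(1 / \<bar>\<mu> j\<bar>) * (\<mu> j)\<^sup>2 \<le> \<kappa> * (\<mu> j)\<^sup>2" by (intro mult_right_mono) auto
    then show ?thesis using False by (simp add: power2_eq_square abs_if split: if_splits)
  qed simp
  have "\<bar>qform M u\<bar> \<le> \<kappa> * vnorm2 (M *\<^sub>v u)" if u: "u \<in> carrier_vec n" for u
  proof -
    define c where "c = mat_adjoint U *\<^sub>v u"
    have c: "c \<in> carrier_vec n" using U u mult_mat_vec_carrier[of "mat_adjoint U" n n u] by (simp add: c_def)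
    have Uc: "U *\<^sub>v c = u" unfolding c_def by (rule unitary_coordinates[OF U u])
    note forms = qform_diagonal[OF U M(1) D c, unfolded Uc]
    have "\<bar>qform M u\<bar> \<le> (\<Sum>j<n. \<bar>\<mu> j * (cmod (c $v j))\<^sup>2\<bar>)" unfolding forms by (rule sum_abs)
    also have "\<dots> \<le> (\<Sum>j<n. \<kappa> * ((\<mu> j)\<^sup>2 * (cmod (c $v j))\<^sup>2))"
    proof (rule sum_mono)
      fix j assume "j \<in> {..<n}"
      then have "\<bar>\<mu> j\<bar> * (cmod (c $v j))\<^sup>2 \<le> (\<kappa> * (\<mu> j)\<^sup>2) * (cmod (c $v j))\<^sup>2"
        using bd by (intro mult_right_mono) auto
      then show "\<bar>\<mu> j * (cmod (c $v j))\<^sup>2\<bar> \<le> \<kappa> * ((\<mu> j)\<^sup>2 * (cmod (c $v j))\<^sup>2)"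
        by (simp add: abs_mult mult.assoc)
    qed
    also have "\<dots> = \<kappa> * vnorm2 (M *\<^sub>v u)" unfolding forms by (simp add: sum_distrib_left)
    finally show ?thesis .
  qed
  with \<kappa> show ?thesis by blast
qed

text \<open>
  The conditions on \<open>c\<close> are \<open>n - 1\<close> homogeneous linear equations in \<open>n\<close> unknowns.  They are
  collected as the rows of a square matrix whose \<open>k\<close>-th row is zero, hence singular.
\<close>

lemma nonzero_vec_vanishing_conditions:
  fixes B :: "complex mat"
  assumes B: "B \<in> carrier_mat n n" and k: "k < n"
  obtains c where "c \<in> carrier_vec n" "c \<noteq> 0\<^sub>v n" "\<And>j. k < j \<Longrightarrow> j < n \<Longrightarrow> c $v j = 0"
    "\<And>j. j < k \<Longrightarrow> (B *\<^sub>v c) $v j = 0"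
proof -
  define f where "f j = (if j < k then row B j else unit_vec n j)" for j
  define T where "T = mat\<^sub>r n n (\<lambda>j. if j = k then 0\<^sub>v n else f j)"
  have f: "f j \<in> carrier_vec n" for j using B by (auto simp: f_def)
  have T: "T \<in> carrier_mat n n" by (simp add: T_def)
  have rowT: "row T j = (if j = k then 0\<^sub>v n else f j)" if "j < n" for j
    unfolding T_def using that f by (intro row_mat_of_row_fun) auto
  have "Determinant.det T = 0"
    unfolding T_def using k f by (intro det_row_0) auto
  then obtain c where c: "c \<in> carrier_vec n" "c \<noteq> 0\<^sub>v n" "T *\<^sub>v c = 0\<^sub>v n"
    using det_0_iff_vec_prod_zero[OF T] by blast
  have *: "row T j \<bullet> c = 0" if "j < n" for j
    using arg_cong[OF c(3), of "\<lambda>w. w $v j"] that T by simp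
  show thesis
  proof (rule that[OF c(1,2)])
    show "c $v j = 0" if "k < j" "j < n" for j
      using *[OF that(2)] rowT[OF that(2)] that c(1) by (simp add: f_def)
    show "(B *\<^sub>v c) $v j = 0" if "j < k" for j
      using *[of j] rowT[of j] that k B by (simp add: f_def)
  qed
qed

text \<open>
  This is the dimension count behind the minimax principle: a nonzero vector \<open>u\<close> is chosen in the
  span of the eigenvectors of \<open>M\<close> for its \<open>i\<close> largest eigenvalues and orthogonal to the
  eigenvectors of \<open>N\<close> for its \<open>i - 1\<close> largest ones.  On \<open>u\<close> the form of \<open>M\<close> is at least, and that of
  \<open>N\<close> at most, the respective \<open>i\<close>-th eigenvalue.
\<close>

lemma nth_largest_eigenvalue_mono:
  assumes M: "M \<in> carrier_mat n n" "hermitian_mat M" and N: "N \<in> carrier_mat n n" "hermitian_mat N"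
    and i: "1 \<le> i" "i \<le> n"
    and le: "\<And>u. u \<in> unit_vecs n \<Longrightarrow> qform M u \<le> qform N u + \<delta>"
  shows "nth_largest_eigenvalue i M \<le> nth_largest_eigenvalue i N + \<delta>"
proof -
  obtain U \<mu> where U: "U \<in> carrier_mat n n" "mat_adjoint U * U = 1\<^sub>m n"
    and D: "mat_adjoint U * M * U = diag_matrix (map (\<lambda>j. complex_of_real (\<mu> j)) [0..<n])"
    and mono: "\<And>p q. p \<le> q \<Longrightarrow> q < n \<Longrightarrow> \<mu> q \<le> \<mu> p"
    and nth: "\<And>i. 1 \<le> i \<Longrightarrow> i \<le> n \<Longrightarrow> nth_largest_eigenvalue i M = \<mu> (i - 1)"
    by (rule hermitian_spectral[OF M]) blast
  obtain V \<nu> where V: "V \<in> carrier_mat n n" "mat_adjoint V * V = 1\<^sub>m n"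
    and D': "mat_adjoint V * N * V = diag_matrix (map (\<lambda>j. complex_of_real (\<nu> j)) [0..<n])"
    and mono': "\<And>p q. p \<le> q \<Longrightarrow> q < n \<Longrightarrow> \<nu> q \<le> \<nu> p"
    and nth': "\<And>i. 1 \<le> i \<Longrightarrow> i \<le> n \<Longrightarrow> nth_largest_eigenvalue i N = \<nu> (i - 1)"
    by (rule hermitian_spectral[OF N]) blast
  define k where "k = i - 1"
  have k: "k < n" using i by (simp add: k_def)
  have VH: "mat_adjoint V \<in> carrier_mat n n" using V(1) by simp
  have VU: "mat_adjoint V * U \<in> carrier_mat n n" using VH U(1) by simp
  obtain c where c: "c \<in> carrier_vec n" "c \<noteq> 0\<^sub>v n" and c0: "\<And>j. k < j \<Longrightarrow> j < n \<Longrightarrow> c $v j = 0"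
    and Vc0: "\<And>j. j < k \<Longrightarrow> ((mat_adjoint V * U) *\<^sub>v c) $v j = 0"
    by (rule nonzero_vec_vanishing_conditions[OF VU k]) blast
  define u where "u = U *\<^sub>v c"
  define d where "d = (mat_adjoint V * U) *\<^sub>v c"
  have u: "u \<in> carrier_vec n" using U c by (simp add: u_def)
  have d: "d \<in> carrier_vec n" using VU c by (simp add: d_def)
  have Vd: "V *\<^sub>v d = u"
    using unitary_coordinates[OF V u] assoc_mult_mat_vec[OF VH U(1) c(1)] by (simp add: d_def u_def)
  have nu: "vnorm2 u = (\<Sum>j<n. (cmod (c $v j))\<^sup>2)" "vnorm2 u = (\<Sum>j<n. (cmod (d $v j))\<^sup>2)"
    using vnorm2_unitary[OF U c(1)] vnorm2_unitary[OF V d] c d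
    by (simp_all add: Vd vnorm2_def[of c] vnorm2_def[of d] flip: u_def)
  have "\<mu> k * vnorm2 u \<le> qform M u"
    unfolding qform_diagonal(1)[OF U M(1) D c(1), folded u_def] nu(1) sum_distrib_left
  proof (rule sum_mono)
    fix j assume j: "j \<in> {..<n}"
    show "\<mu> k * (cmod (c $v j))\<^sup>2 \<le> \<mu> j * (cmod (c $v j))\<^sup>2"
    proof (cases "j \<le> k")
      case True
      then show ?thesis using mono[of j k] k by (intro mult_right_mono) auto
    next
      case False
      then show ?thesis using c0[of j] j by simp
    qed
  qed
  moreover have "qform N u \<le> \<nu> k * vnorm2 u"
    unfolding qform_diagonal(1)[OF V N(1) D' d, unfolded Vd] nu(2) sum_distrib_left
  proof (rule sum_mono)
    fix j assume j: "j \<in> {..<n}"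
    show "\<nu> j * (cmod (d $v j))\<^sup>2 \<le> \<nu> k * (cmod (d $v j))\<^sup>2"
    proof (cases "k \<le> j")
      case True
      then show ?thesis using mono'[of k j] j by (intro mult_right_mono) auto
    next
      case False
      then show ?thesis using Vc0[of j] by (simp add: d_def)
    qed
  qed
  moreover have pos: "0 < vnorm2 u"
  proof -
    have "vnorm2 u \<noteq> 0"
    proof
      assume "vnorm2 u = 0"
      then have "c \<bullet>c c = 0"
        using vnorm2_unitary[OF U c(1)] by (simp add: u_def cscalar_self_vnorm2)
      then show False using c by simp
    qed
    then show ?thesis using vnorm2_nonneg[of u] by simp
  qed
  moreover have "qform M u \<le> qform N u + \<delta> * vnorm2 u"
  proof -
    define a where "a = complex_of_real (1 / sqrt (vnorm2 u))"
    have a: "(cmod a)\<^sup>2 = 1 / vnorm2 u" using pos by (simp add: a_def norm_divide power_divide)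
    have "a \<cdot>\<^sub>v u \<in> unit_vecs n"
      using u pos by (simp add: unit_vecs_vnorm2 vnorm2_smult a)
    moreover have "qform T (a \<cdot>\<^sub>v u) = qform T u / vnorm2 u" if "T \<in> carrier_mat n n" for T
    proof -
      have "(T *\<^sub>v (a \<cdot>\<^sub>v u)) \<bullet>c (a \<cdot>\<^sub>v u) = a * cnj a * ((T *\<^sub>v u) \<bullet>c u)"
        using that u by (simp add: mult_mat_vec conjugate_smult_vec)
      also have "a * cnj a = complex_of_real (1 / vnorm2 u)"
        using a by (metis complex_norm_square of_real_power)
      finally show ?thesis by (simp add: qform_def)
    qed
    ultimately have "qform M u / vnorm2 u \<le> qform N u / vnorm2 u + \<delta>"
      using le[of "a \<cdot>\<^sub>v u"] M N by simp
    then show ?thesis using pos by (simp add: field_simps)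
  qed
  ultimately have "\<mu> k * vnorm2 u \<le> (\<nu> k + \<delta>) * vnorm2 u" by (simp add: algebra_simps)
  then have "\<mu> k \<le> \<nu> k + \<delta>" using pos by simp
  then show ?thesis using nth[OF i] nth'[OF i] by (simp add: k_def)
qed

lemma nth_largest_eigenvector:
  assumes M: "M \<in> carrier_mat n n" "hermitian_mat M" and i: "1 \<le> i" "i \<le> n"
  shows "\<exists>u\<in>unit_vecs n. M *\<^sub>v u = complex_of_real (nth_largest_eigenvalue i M) \<cdot>\<^sub>v u"
proof -
  obtain U \<mu> where U: "U \<in> carrier_mat n n" "mat_adjoint U * U = 1\<^sub>m n"
    and D: "mat_adjoint U * M * U = diag_matrix (map (\<lambda>j. complex_of_real (\<mu> j)) [0..<n])"
    and nth: "\<And>i. 1 \<le> i \<Longrightarrow> i \<le> n \<Longrightarrow> nth_largest_eigenvalue i M = \<mu> (i - 1)"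
    by (rule hermitian_spectral[OF M]) blast
  let ?e = "unit_vec n (i - 1) :: complex Matrix.vec"
  have e: "?e \<in> carrier_vec n" by simp
  have "vnorm2 ?e = (\<Sum>p<n. if p = i - 1 then 1 else 0)"
    unfolding vnorm2_def by (rule sum.cong) (use i in auto)
  also have "\<dots> = 1" using i by (simp add: sum.delta)
  finally have "U *\<^sub>v ?e \<in> unit_vecs n"
    using U vnorm2_unitary[OF U e] by (simp add: unit_vecs_vnorm2)
  moreover have "Matrix.vec n (\<lambda>j. complex_of_real (\<mu> j) * ?e $v j) = complex_of_real (\<mu> (i - 1)) \<cdot>\<^sub>v ?e"
    using i by (intro eq_vecI) auto
  then have "M *\<^sub>v (U *\<^sub>v ?e) = complex_of_real (\<mu> (i - 1)) \<cdot>\<^sub>v (U *\<^sub>v ?e)"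
    using unitary_diagonal_apply[OF U M(1) D e] mult_mat_vec[OF U(1) e] by simp
  ultimately show ?thesis using nth[OF i] by auto
qed

section \<open>Limits and residuals in terms of vector entries\<close>

lemma mult_mat_vec_sum:
  assumes "M \<in> carrier_mat n n" "u \<in> carrier_vec n" "p < n"
  shows "(M *\<^sub>v u) $v p = (\<Sum>q<n. M $$ (p, q) * u $v q)"
  using assms by (auto simp: scalar_prod_def lessThan_atLeast0 intro!: sum.cong)

lemma qform_sum:
  assumes "M \<in> carrier_mat n n" "u \<in> carrier_vec n"
  shows "qform M u = Re (\<Sum>p<n. (M *\<^sub>v u) $v p * cnj (u $v p))"
  using assms by (simp add: qform_def scalar_prod_def lessThan_atLeast0)

lemma cmod_unit_vec_le:
  assumes "u \<in> unit_vecs n" "p < n"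
  shows "cmod (u $v p) \<le> 1"
proof -
  have u: "dim_vec u = n" "vnorm2 u = 1" using assms(1) by (auto simp: unit_vecs_vnorm2)
  have "(cmod (u $v p))\<^sup>2 \<le> vnorm2 u"
    unfolding vnorm2_def using assms(2) u by (intro member_le_sum) auto
  then show ?thesis using u by (simp add: abs_square_le_1)
qed

lemma bounded_complex_components_subseq:
  fixes f :: "nat \<Rightarrow> nat \<Rightarrow> complex"
  assumes "\<And>j p. p < m \<Longrightarrow> cmod (f j p) \<le> 1"
  shows "\<exists>r l. strict_mono (r :: nat \<Rightarrow> nat) \<and> (\<forall>p<m. (\<lambda>j. f (r j) p) \<longlonglongrightarrow> l p)"
  using assms
proof (induction m)
  case 0
  show ?case by (intro exI[of _ "\<lambda>j. j"]) (simp add: strict_mono_def)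
next
  case (Suc m)
  then obtain r :: "nat \<Rightarrow> nat" and l where r: "strict_mono r" "\<And>p. p < m \<Longrightarrow> (\<lambda>j. f (r j) p) \<longlonglongrightarrow> l p"
    by (metis less_Suc_eq)
  have "\<forall>j. f (r j) m \<in> cball 0 1" using Suc.prems by simp
  moreover have "seq_compact (cball (0 :: complex) 1)"
    using compact_cball by (simp add: compact_eq_seq_compact_metric)
  ultimately obtain z and s :: "nat \<Rightarrow> nat" where s: "strict_mono s" "((\<lambda>j. f (r j) m) \<circ> s) \<longlonglongrightarrow> z"
    unfolding seq_compact_def by meson
  have "(\<lambda>j. f ((r \<circ> s) j) p) \<longlonglongrightarrow> (l(m := z)) p" if "p < Suc m" for p
  proof (cases "p = m")
    case True
    then show ?thesis using s(2) by (simp add: o_def)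
  next
    case False
    then have "(\<lambda>j. f (r j) p) \<longlonglongrightarrow> l p" using that r(2) by simp
    from LIMSEQ_subseq_LIMSEQ[OF this s(1)] show ?thesis using False by (simp add: o_def)
  qed
  then show ?case using strict_mono_o[OF r(1) s(1)] by blast
qed

text \<open>
  Carrier-based vectors have no topology, so the compactness of the unit sphere is expressed
  through convergence of the entries.
\<close>

lemma unit_vecs_subseq:
  assumes u: "\<And>j. u j \<in> unit_vecs n"
  obtains r :: "nat \<Rightarrow> nat" and v where "strict_mono r" "v \<in> unit_vecs n"
    "\<And>p. p < n \<Longrightarrow> (\<lambda>j. u (r j) $v p) \<longlonglongrightarrow> v $v p"
proof -
  obtain r :: "nat \<Rightarrow> nat" and l where r: "strict_mono r" and l: "\<And>p. p < n \<Longrightarrow> (\<lambda>j. u (r j) $v p) \<longlonglongrightarrow> l p"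
    using bounded_complex_components_subseq[of n "\<lambda>j p. u j $v p"] cmod_unit_vec_le[OF u] by blast
  define v where "v = Matrix.vec n l"
  have lim: "(\<lambda>j. u (r j) $v p) \<longlonglongrightarrow> v $v p" if "p < n" for p
    using l[OF that] that by (simp add: v_def)
  have dim: "dim_vec (u j) = n" for j using u[of j] by (auto simp: unit_vecs_vnorm2)
  have "(\<lambda>j. \<Sum>p<n. (cmod (u (r j) $v p))\<^sup>2) \<longlonglongrightarrow> (\<Sum>p<n. (cmod (v $v p))\<^sup>2)"
    by (intro tendsto_intros lim) auto
  moreover have "(\<Sum>p<n. (cmod (u (r j) $v p))\<^sup>2) = 1" for j
    using u[of "r j"] by (simp add: unit_vecs_vnorm2 vnorm2_def dim)
  ultimately have "(\<Sum>p<n. (cmod (v $v p))\<^sup>2) = 1"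
    by (simp add: LIMSEQ_const_iff)
  then have "v \<in> unit_vecs n" by (simp add: unit_vecs_vnorm2 vnorm2_def v_def)
  with r lim that show thesis by blast
qed

lemma mult_mat_vec_tendsto:
  fixes M :: "complex mat"
  assumes M: "M \<in> carrier_mat n n" and u: "\<And>j. u j \<in> carrier_vec n" and v: "v \<in> carrier_vec n"
    and lim: "\<And>p. p < n \<Longrightarrow> (\<lambda>j. u j $v p) \<longlonglongrightarrow> v $v p" and p: "p < n"
  shows "(\<lambda>j. (M *\<^sub>v u j) $v p) \<longlonglongrightarrow> (M *\<^sub>v v) $v p"
  unfolding mult_mat_vec_sum[OF M u p] mult_mat_vec_sum[OF M v p]
  by (intro tendsto_intros lim) auto

lemma qform_tendsto:
  assumes M: "M \<in> carrier_mat n n" and u: "\<And>j. u j \<in> carrier_vec n" and v: "v \<in> carrier_vec n"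
    and lim: "\<And>p. p < n \<Longrightarrow> (\<lambda>j. u j $v p) \<longlonglongrightarrow> v $v p"
  shows "(\<lambda>j. qform M (u j)) \<longlonglongrightarrow> qform M v"
  unfolding qform_sum[OF M u] qform_sum[OF M v]
  by (intro tendsto_intros mult_mat_vec_tendsto[OF M u v lim] lim) auto

lemma hermitian_entry:
  assumes "M \<in> carrier_mat n n" "hermitian_mat M" "p < n" "q < n"
  shows "cnj (M $$ (q, p)) = M $$ (p, q)"
proof -
  have "M $$ (p, q) = mat_adjoint M $$ (p, q)" using assms(2) by (simp only: hermitian_mat_def)
  also have "\<dots> = cnj (M $$ (q, p))" using assms by simp
  finally show ?thesis ..
qed

text \<open>
  This is \<open>hermitian_form_le_residual\<close> for \<open>M\<close> shifted by \<open>e\<close>, with the residual written out in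
  entries.
\<close>

lemma eigenvalue_shift_residual:
  assumes M: "M \<in> carrier_mat n n" "hermitian_mat M"
  shows "\<exists>\<kappa>\<ge>0. \<forall>u\<in>unit_vecs n.
    \<bar>qform M u - e\<bar> \<le> \<kappa> * (\<Sum>p<n. (cmod ((M *\<^sub>v u) $v p - complex_of_real e * u $v p))\<^sup>2)"
proof -
  define H where "H = Matrix.mat n n (\<lambda>(p, q). M $$ (p, q) - (if p = q then complex_of_real e else 0))"
  have H: "H \<in> carrier_mat n n" by (simp add: H_def)
  have "hermitian_mat H"
    unfolding hermitian_mat_def by (intro eq_matI) (auto simp: H_def hermitian_entry[OF M])
  from hermitian_form_le_residual[OF H this] obtain \<kappa> where \<kappa>: "0 \<le> \<kappa>"
    "\<And>u. u \<in> carrier_vec n \<Longrightarrow> \<bar>qform H u\<bar> \<le> \<kappa> * vnorm2 (H *\<^sub>v u)" by blast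
  have "\<bar>qform M u - e\<bar> \<le> \<kappa> * (\<Sum>p<n. (cmod ((M *\<^sub>v u) $v p - complex_of_real e * u $v p))\<^sup>2)"
    if "u \<in> unit_vecs n" for u
  proof -
    have u: "u \<in> carrier_vec n" and u1: "vnorm2 u = 1" using that by (auto simp: unit_vecs_vnorm2)
    have Hu: "(H *\<^sub>v u) $v p = (M *\<^sub>v u) $v p - complex_of_real e * u $v p" if "p < n" for p
    proof -
      have "(H *\<^sub>v u) $v p = (\<Sum>q<n. M $$ (p, q) * u $v q - (if q = p then complex_of_real e * u $v q else 0))"
        unfolding mult_mat_vec_sum[OF H u that]
        using that by (intro sum.cong) (auto simp: H_def left_diff_distrib)
      then show ?thesis
        using that by (simp add: sum_subtractf mult_mat_vec_sum[OF M(1) u that] sum.delta)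
    qed
    have "(\<Sum>p<n. (cmod (u $v p))\<^sup>2) = 1" using u u1 by (simp add: vnorm2_def)
    then have "(\<Sum>p<n. u $v p * cnj (u $v p)) = 1"
      by (metis (no_types, lifting) complex_norm_square of_real_1 of_real_sum of_real_power sum.cong)
    then have "qform H u = qform M u - e"
      unfolding qform_sum[OF H u] qform_sum[OF M(1) u]
      by (simp add: Hu left_diff_distrib sum_subtractf mult.assoc flip: sum_distrib_left)
    moreover have "vnorm2 (H *\<^sub>v u) = (\<Sum>p<n. (cmod ((M *\<^sub>v u) $v p - complex_of_real e * u $v p))\<^sup>2)"
      unfolding vnorm2_def using H by (intro sum.cong) (auto simp: Hu simp del: index_mult_mat_vec)
    ultimately show ?thesis using \<kappa>(2)[OF u] by simp
  qed
  with \<kappa>(1) show ?thesis by blast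
qed

section \<open>Eigenvalue gradients of a multiparameter problem\<close>

locale hermitian_mep =
  fixes n :: "'m::finite \<Rightarrow> nat"
    and A0 :: "'m \<Rightarrow> complex mat"
    and A :: "'m \<Rightarrow> 'm \<Rightarrow> complex mat"
    and i :: "'m \<Rightarrow> nat"
  assumes A0: "\<And>k. A0 k \<in> carrier_mat (n k) (n k)"
    and A: "\<And>k l. A k l \<in> carrier_mat (n k) (n k)"
    and herm0: "\<And>k. hermitian_mat (A0 k)"
    and herm: "\<And>k l. hermitian_mat (A k l)"
    and idx: "\<And>k. 1 \<le> i k \<and> i k \<le> n k"
begin

abbreviation pencil :: "real ^ 'm \<Rightarrow> 'm \<Rightarrow> complex mat" where
  "pencil \<equiv> mep_pencil n A0 A"

abbreviation \<epsilon> :: "'m \<Rightarrow> real ^ 'm \<Rightarrow> real" where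
  "\<epsilon> k x \<equiv> mep_fun n A0 A i x $ k"

definition form_gradient :: "'m \<Rightarrow> complex Matrix.vec \<Rightarrow> real ^ 'm" where
  "form_gradient k u = (\<chi> l. qform (A k l) u)"

text \<open>
  At a multiple eigenvalue this set can contain more than one vector.
\<close>

definition eigen_gradients :: "'m \<Rightarrow> real ^ 'm \<Rightarrow> (real ^ 'm) set" where
  "eigen_gradients k x = form_gradient k `
     {u \<in> unit_vecs (n k). pencil x k *\<^sub>v u = complex_of_real (\<epsilon> k x) \<cdot>\<^sub>v u}"

lemma pencil_carrier: "pencil x k \<in> carrier_mat (n k) (n k)"
  by (simp add: mep_pencil_def)

lemma pencil_hermitian: "hermitian_mat (pencil x k)"
  unfolding hermitian_mat_def
  by (intro eq_matI)
    (auto simp: mep_pencil_def hermitian_entry[OF A0 herm0] hermitian_entry[OF A herm])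

lemma pencil_mult_vec:
  assumes u: "u \<in> carrier_vec (n k)" and p: "p < n k"
  shows "(pencil x k *\<^sub>v u) $v p =
    (A0 k *\<^sub>v u) $v p + (\<Sum>l\<in>UNIV. complex_of_real (x $ l) * (A k l *\<^sub>v u) $v p)"
proof -
  have "(pencil x k *\<^sub>v u) $v p = (\<Sum>q<n k. A0 k $$ (p, q) * u $v q)
      + (\<Sum>q<n k. \<Sum>l\<in>UNIV. complex_of_real (x $ l) * (A k l $$ (p, q) * u $v q))"
    unfolding mult_mat_vec_sum[OF pencil_carrier u p] sum.distrib[symmetric]
    using p by (intro sum.cong) (auto simp: mep_pencil_def distrib_right sum_distrib_right mult.assoc)
  also have "(\<Sum>q<n k. \<Sum>l\<in>UNIV. complex_of_real (x $ l) * (A k l $$ (p, q) * u $v q))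
      = (\<Sum>l\<in>UNIV. \<Sum>q<n k. complex_of_real (x $ l) * (A k l $$ (p, q) * u $v q))"
    by (rule sum.swap)
  finally show ?thesis
    by (simp add: mult_mat_vec_sum[OF A0 u p] mult_mat_vec_sum[OF A u p] sum_distrib_left
        del: index_mult_mat_vec)
qed

lemma qform_pencil:
  assumes u: "u \<in> carrier_vec (n k)"
  shows "qform (pencil x k) u = qform (A0 k) u + inner (form_gradient k u) x"
proof -
  have "(\<Sum>p<n k. (pencil x k *\<^sub>v u) $v p * cnj (u $v p)) = (\<Sum>p<n k. (A0 k *\<^sub>v u) $v p * cnj (u $v p))
      + (\<Sum>p<n k. \<Sum>l\<in>UNIV. complex_of_real (x $ l) * ((A k l *\<^sub>v u) $v p * cnj (u $v p)))"
    unfolding sum.distrib[symmetric]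
    by (intro sum.cong) (auto simp: pencil_mult_vec[OF u] distrib_right sum_distrib_right mult.assoc
        simp del: index_mult_mat_vec)
  also have "(\<Sum>p<n k. \<Sum>l\<in>UNIV. complex_of_real (x $ l) * ((A k l *\<^sub>v u) $v p * cnj (u $v p)))
      = (\<Sum>l\<in>UNIV. complex_of_real (x $ l) * (\<Sum>p<n k. (A k l *\<^sub>v u) $v p * cnj (u $v p)))"
    unfolding sum_distrib_left by (rule sum.swap)
  moreover have "Re (\<Sum>l\<in>UNIV. complex_of_real (x $ l) * Z l) = (\<Sum>l\<in>UNIV. Re (Z l) * x $ l)" for Z
    by (simp add: mult.commute)
  ultimately show ?thesis
    by (simp only: qform_sum[OF pencil_carrier u] qform_sum[OF A0 u] form_gradient_def qform_sum[OF A u]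
        inner_vec_def plus_complex.sel vec_lambda_beta inner_real_def)
qed

lemma form_gradient_tendsto:
  assumes "\<And>j. u j \<in> carrier_vec (n k)" "v \<in> carrier_vec (n k)"
    and "\<And>p. p < n k \<Longrightarrow> (\<lambda>j. u j $v p) \<longlonglongrightarrow> v $v p"
  shows "(\<lambda>j. form_gradient k (u j)) \<longlonglongrightarrow> form_gradient k v"
  unfolding form_gradient_def by (intro tendsto_vec_lambda qform_tendsto[OF A assms])

lemma compact_form_gradients: "compact (form_gradient k ` unit_vecs (n k))"
  unfolding compact_eq_seq_compact_metric seq_compact_def
proof (intro allI impI)
  fix f :: "nat \<Rightarrow> real ^ 'm"
  assume "\<forall>j. f j \<in> form_gradient k ` unit_vecs (n k)"
  then have "\<forall>j. \<exists>u. u \<in> unit_vecs (n k) \<and> f j = form_gradient k u" by blast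
  then obtain u where u: "\<And>j. u j \<in> unit_vecs (n k)" "\<And>j. f j = form_gradient k (u j)" by metis
  obtain r :: "nat \<Rightarrow> nat" and v where r: "strict_mono r" and v: "v \<in> unit_vecs (n k)"
    and lim: "\<And>p. p < n k \<Longrightarrow> (\<lambda>j. u (r j) $v p) \<longlonglongrightarrow> v $v p"
    by (rule unit_vecs_subseq[of u, OF u(1)]) blast
  have "(\<lambda>j. form_gradient k (u (r j))) \<longlonglongrightarrow> form_gradient k v"
    by (rule form_gradient_tendsto[OF _ _ lim]) (use u v in \<open>auto simp: unit_vecs_def\<close>)
  then have "(f \<circ> r) \<longlonglongrightarrow> form_gradient k v" by (simp add: o_def u(2))
  with r v show "\<exists>l\<in>form_gradient k ` unit_vecs (n k). \<exists>r. strict_mono r \<and> (f \<circ> r) \<longlonglongrightarrow> l" by blast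
qed

text \<open>
  The forms of \<open>pencil x k\<close> and \<open>pencil y k\<close> at a unit vector \<open>u\<close> differ by
  \<open>inner (form_gradient k u) (x - y)\<close>, and the gradients of all unit vectors are bounded.
\<close>

lemma eigenvalue_lipschitz:
  obtains c where "0 \<le> c" "\<And>x y. \<bar>\<epsilon> k x - \<epsilon> k y\<bar> \<le> c * norm (x - y)"
proof -
  obtain c where c: "\<And>u. u \<in> unit_vecs (n k) \<Longrightarrow> norm (form_gradient k u) \<le> c" "0 < c"
    using compact_imp_bounded[OF compact_form_gradients[of k]] unfolding bounded_pos by blast
  have le: "\<epsilon> k x \<le> \<epsilon> k y + c * norm (x - y)" for x y
  proof -
    have "qform (pencil x k) u \<le> qform (pencil y k) u + c * norm (x - y)" if "u \<in> unit_vecs (n k)" for u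
    proof -
      have "inner (form_gradient k u) (x - y) \<le> norm (form_gradient k u) * norm (x - y)"
        by (rule norm_cauchy_schwarz)
      also have "\<dots> \<le> c * norm (x - y)" using c(1)[OF that] by (intro mult_right_mono) auto
      finally show ?thesis
        using that by (simp add: unit_vecs_def qform_pencil inner_diff_right)
    qed
    from nth_largest_eigenvalue_mono[OF pencil_carrier pencil_hermitian pencil_carrier pencil_hermitian _ _ this]
    show ?thesis using idx[of k] by (simp add: mep_fun_def)
  qed
  have "\<bar>\<epsilon> k x - \<epsilon> k y\<bar> \<le> c * norm (x - y)" for x y
    using le[of x y] le[of y x] by (simp add: norm_minus_commute abs_le_iff)
  with c(2) that show thesis by (meson less_imp_le)
qed

lemma eigen_gradients_nonempty: "eigen_gradients k x \<noteq> {}"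
  using nth_largest_eigenvector[OF pencil_carrier pencil_hermitian, of "i k" k x] idx[of k]
  by (auto simp: eigen_gradients_def mep_fun_def)

lemma eigen_gradients_closed_graph:
  assumes x: "x \<longlonglongrightarrow> a" and g: "\<And>j. g j \<in> eigen_gradients k (x j)" and l: "g \<longlonglongrightarrow> l"
  shows "l \<in> eigen_gradients k a"
proof -
  have "\<forall>j. \<exists>u. u \<in> unit_vecs (n k) \<and> pencil (x j) k *\<^sub>v u = complex_of_real (\<epsilon> k (x j)) \<cdot>\<^sub>v u
      \<and> g j = form_gradient k u"
    using g by (auto simp: eigen_gradients_def)
  then obtain u where u: "\<And>j. u j \<in> unit_vecs (n k)"
    and eig: "\<And>j. pencil (x j) k *\<^sub>v u j = complex_of_real (\<epsilon> k (x j)) \<cdot>\<^sub>v u j"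
    and gu: "\<And>j. g j = form_gradient k (u j)" by metis
  obtain r :: "nat \<Rightarrow> nat" and v where r: "strict_mono r" and v: "v \<in> unit_vecs (n k)"
    and lim: "\<And>p. p < n k \<Longrightarrow> (\<lambda>j. u (r j) $v p) \<longlonglongrightarrow> v $v p"
    by (rule unit_vecs_subseq[of u, OF u]) blast
  have uc: "u j \<in> carrier_vec (n k)" for j using u by (auto simp: unit_vecs_def)
  have vc: "v \<in> carrier_vec (n k)" using v by (auto simp: unit_vecs_def)
  have "(\<lambda>j. g (r j)) \<longlonglongrightarrow> form_gradient k v"
    unfolding gu by (rule form_gradient_tendsto[OF uc vc lim])
  moreover have "(\<lambda>j. g (r j)) \<longlonglongrightarrow> l" using LIMSEQ_subseq_LIMSEQ[OF l r] by (simp add: o_def)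
  ultimately have lv: "l = form_gradient k v" by (rule LIMSEQ_unique[rotated])
  have xr: "(\<lambda>j. x (r j)) \<longlonglongrightarrow> a" using LIMSEQ_subseq_LIMSEQ[OF x r] by (simp add: o_def)
  have ev: "(\<lambda>j. \<epsilon> k (x (r j))) \<longlonglongrightarrow> \<epsilon> k a"
  proof -
    obtain c where "\<And>x y. \<bar>\<epsilon> k x - \<epsilon> k y\<bar> \<le> c * norm (x - y)" by (rule eigenvalue_lipschitz) blast
    then have bd: "norm (\<epsilon> k (x (r j)) - \<epsilon> k a) \<le> c * norm (x (r j) - a)" for j by simp
    have "(\<lambda>j. c * norm (x (r j) - a)) \<longlonglongrightarrow> 0"
      using tendsto_norm_zero[OF LIM_zero[OF xr]] by (rule tendsto_mult_right_zero)
    then have "(\<lambda>j. \<epsilon> k (x (r j)) - \<epsilon> k a) \<longlonglongrightarrow> 0"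
      by (rule Lim_null_comparison[OF always_eventually[OF allI[OF bd]]])
    then show ?thesis by (simp add: LIM_zero_iff)
  qed
  have "pencil a k *\<^sub>v v = complex_of_real (\<epsilon> k a) \<cdot>\<^sub>v v"
  proof (rule eq_vecI)
    fix p assume "p < dim_vec (complex_of_real (\<epsilon> k a) \<cdot>\<^sub>v v)"
    then have p: "p < n k" using vc by simp
    have "(\<lambda>j. (pencil (x (r j)) k *\<^sub>v u (r j)) $v p) \<longlonglongrightarrow> (pencil a k *\<^sub>v v) $v p"
      unfolding pencil_mult_vec[OF uc p] pencil_mult_vec[OF vc p]
      by (intro tendsto_intros mult_mat_vec_tendsto[OF A0 uc vc lim p]
          mult_mat_vec_tendsto[OF A uc vc lim p] xr)
    moreover have "(\<lambda>j. (pencil (x (r j)) k *\<^sub>v u (r j)) $v p) \<longlonglongrightarrow> complex_of_real (\<epsilon> k a) * v $v p"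
    proof -
      have "(pencil (x (r j)) k *\<^sub>v u (r j)) $v p = complex_of_real (\<epsilon> k (x (r j))) * u (r j) $v p" for j
        unfolding eig using uc[of "r j"] p by simp
      moreover have "(\<lambda>j. complex_of_real (\<epsilon> k (x (r j))) * u (r j) $v p) \<longlonglongrightarrow> complex_of_real (\<epsilon> k a) * v $v p"
        by (intro tendsto_intros ev lim p)
      ultimately show ?thesis by simp
    qed
    ultimately have "(pencil a k *\<^sub>v v) $v p = complex_of_real (\<epsilon> k a) * v $v p"
      by (rule LIMSEQ_unique)
    then show "(pencil a k *\<^sub>v v) $v p = (complex_of_real (\<epsilon> k a) \<cdot>\<^sub>v v) $v p" using vc p by simp
  qed (use vc pencil_carrier[of a k] in auto)
  with v lv show ?thesis by (auto simp: eigen_gradients_def)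
qed

text \<open>
  The gradient is taken at an eigenvector for \<open>x\<close>, whereas the remainder turns out to be the form
  of the pencil at \<open>y\<close>, shifted by \<open>\<epsilon> k y\<close>.  Its residual at that eigenvector is of first order in
  \<open>x - y\<close>, and \<open>eigenvalue_shift_residual\<close> squares it.  The constant depends on \<open>y\<close> through
  the distances from \<open>\<epsilon> k y\<close> to the other eigenvalues of the pencil at \<open>y\<close>.
\<close>

lemma eigenvalue_quadratic_remainder:
  "\<exists>C. \<forall>x. \<forall>g\<in>eigen_gradients k x. \<bar>\<epsilon> k x - \<epsilon> k y - inner g (x - y)\<bar> \<le> C * (norm (x - y))\<^sup>2"
proof -
  obtain \<kappa> where \<kappa>: "0 \<le> \<kappa>" and resid: "\<And>u. u \<in> unit_vecs (n k) \<Longrightarrow> \<bar>qform (pencil y k) u - \<epsilon> k y\<bar>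
      \<le> \<kappa> * (\<Sum>p<n k. (cmod ((pencil y k *\<^sub>v u) $v p - complex_of_real (\<epsilon> k y) * u $v p))\<^sup>2)"
    using eigenvalue_shift_residual[OF pencil_carrier pencil_hermitian, of k y "\<epsilon> k y"] by blast
  obtain c where c: "0 \<le> c" "\<And>x y. \<bar>\<epsilon> k x - \<epsilon> k y\<bar> \<le> c * norm (x - y)" by (rule eigenvalue_lipschitz) blast
  \<comment> \<open>\<open>S p\<close> bounds entry \<open>p\<close> of the residual per unit of \<open>norm (x - y)\<close>: the sum comes from the
    change of the pencil, the summand \<open>c\<close> from the change of the eigenvalue.\<close>
  define S where "S p = (\<Sum>l\<in>UNIV. \<Sum>q<n k. cmod (A k l $$ (p, q))) + c" for p
  have "\<bar>\<epsilon> k x - \<epsilon> k y - inner g (x - y)\<bar> \<le> (\<kappa> * (\<Sum>p<n k. (S p)\<^sup>2)) * (norm (x - y))\<^sup>2"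
    if "g \<in> eigen_gradients k x" for x g
  proof -
    from that obtain u where u: "u \<in> unit_vecs (n k)" and g: "g = form_gradient k u"
      and eig: "pencil x k *\<^sub>v u = complex_of_real (\<epsilon> k x) \<cdot>\<^sub>v u" by (auto simp: eigen_gradients_def)
    have uc: "u \<in> carrier_vec (n k)" and u1: "vnorm2 u = 1" using u by (auto simp: unit_vecs_vnorm2)
    have "qform (pencil x k) u = \<epsilon> k x"
      unfolding qform_def eig using uc by (simp add: cscalar_self_vnorm2 u1)
    then have eq: "\<epsilon> k x - \<epsilon> k y - inner g (x - y) = qform (pencil y k) u - \<epsilon> k y"
      by (simp add: qform_pencil[OF uc] g inner_diff_right)
    have entry: "cmod ((pencil y k *\<^sub>v u) $v p - complex_of_real (\<epsilon> k y) * u $v p) \<le> S p * norm (x - y)"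
      if p: "p < n k" for p
    proof -
      have Au: "cmod ((A k l *\<^sub>v u) $v p) \<le> (\<Sum>q<n k. cmod (A k l $$ (p, q)))" for l
        unfolding mult_mat_vec_sum[OF A uc p] using cmod_unit_vec_le[OF u]
        by (intro sum_norm_le) (simp add: norm_mult mult_left_le)
      have "(pencil y k *\<^sub>v u) $v p - complex_of_real (\<epsilon> k y) * u $v p
          = ((pencil y k *\<^sub>v u) $v p - (pencil x k *\<^sub>v u) $v p) + complex_of_real (\<epsilon> k x - \<epsilon> k y) * u $v p"
        unfolding eig using uc p by (simp add: algebra_simps del: index_mult_mat_vec)
      also have "(pencil y k *\<^sub>v u) $v p - (pencil x k *\<^sub>v u) $v p
          = (\<Sum>l\<in>UNIV. complex_of_real ((y - x) $ l) * (A k l *\<^sub>v u) $v p)"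
        unfolding pencil_mult_vec[OF uc p]
        by (simp add: sum_subtractf left_diff_distrib del: index_mult_mat_vec)
      finally have "cmod ((pencil y k *\<^sub>v u) $v p - complex_of_real (\<epsilon> k y) * u $v p)
          \<le> cmod (\<Sum>l\<in>UNIV. complex_of_real ((y - x) $ l) * (A k l *\<^sub>v u) $v p)
            + cmod (complex_of_real (\<epsilon> k x - \<epsilon> k y) * u $v p)"
        by (simp only: norm_triangle_ineq)
      also have "\<dots> \<le> (\<Sum>l\<in>UNIV. norm (x - y) * (\<Sum>q<n k. cmod (A k l $$ (p, q)))) + (c * norm (x - y)) * 1"
      proof (rule add_mono)
        show "cmod (\<Sum>l\<in>UNIV. complex_of_real ((y - x) $ l) * (A k l *\<^sub>v u) $v p)
            \<le> (\<Sum>l\<in>UNIV. norm (x - y) * (\<Sum>q<n k. cmod (A k l $$ (p, q))))"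
        proof (rule sum_norm_le)
          fix l
          have "\<bar>(y - x) $ l\<bar> \<le> norm (x - y)" using component_le_norm_cart[of "y - x" l] by (simp add: norm_minus_commute)
          then show "cmod (complex_of_real ((y - x) $ l) * (A k l *\<^sub>v u) $v p)
              \<le> norm (x - y) * (\<Sum>q<n k. cmod (A k l $$ (p, q)))"
            unfolding norm_mult norm_of_real using Au[of l] by (intro mult_mono) (auto simp del: index_mult_mat_vec)
        qed
        show "cmod (complex_of_real (\<epsilon> k x - \<epsilon> k y) * u $v p) \<le> (c * norm (x - y)) * 1"
          unfolding norm_mult norm_of_real using c cmod_unit_vec_le[OF u p] by (intro mult_mono) auto
      qed
      also have "\<dots> = S p * norm (x - y)"
        by (simp add: S_def algebra_simps flip: sum_distrib_left)
      finally show ?thesis .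
    qed
    have "\<bar>\<epsilon> k x - \<epsilon> k y - inner g (x - y)\<bar>
        \<le> \<kappa> * (\<Sum>p<n k. (cmod ((pencil y k *\<^sub>v u) $v p - complex_of_real (\<epsilon> k y) * u $v p))\<^sup>2)"
      unfolding eq by (rule resid[OF u])
    also have "\<dots> \<le> \<kappa> * (\<Sum>p<n k. (S p * norm (x - y))\<^sup>2)"
      using \<kappa> entry by (intro mult_left_mono sum_mono power_mono) auto
    also have "\<dots> = (\<kappa> * (\<Sum>p<n k. (S p)\<^sup>2)) * (norm (x - y))\<^sup>2"
      by (simp add: power_mult_distrib sum_distrib_right mult.assoc)
    finally show ?thesis .
  qed
  then show ?thesis by blast
qed

text \<open>
  Right definiteness is a condition on a complex determinant; its entries are real because the
  coefficients are Hermitian.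
\<close>

lemma right_definite_det_pos:
  assumes rd: "right_definite n A" and M: "\<And>k. M $ k \<in> form_gradient k ` unit_vecs (n k)"
  shows "0 < Determinants.det M"
proof -
  have "\<forall>k. \<exists>u. u \<in> unit_vecs (n k) \<and> M $ k = form_gradient k u" using M by blast
  then obtain u where u: "\<And>k. u k \<in> unit_vecs (n k)" and Mu: "\<And>k. M $ k = form_gradient k (u k)" by metis
  have entry: "(A k l *\<^sub>v u k) \<bullet>c u k = complex_of_real (M $ k $ l)" for k l
    using hermitian_form_real[OF A herm, of "u k" k l] u[of k]
    by (simp add: Mu form_gradient_def qform_def unit_vecs_def)
  have "0 < Determinants.det (\<chi> k l. (A k l *\<^sub>v u k) \<bullet>c u k)" using rd u by (auto simp: right_definite_def)
  also have "(\<chi> k l. (A k l *\<^sub>v u k) \<bullet>c u k) = (\<chi> k l. complex_of_real (M $ k $ l))"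
    by (simp add: entry)
  also have "Determinants.det (\<chi> k l. complex_of_real (M $ k $ l)) = complex_of_real (Determinants.det M)"
    by (simp add: Determinants.det_def)
  finally show ?thesis by (simp add: less_complex_def)
qed

end

section \<open>Local quadratic convergence\<close>

theorem mainTheorem1:
  fixes n :: "'m::finite \<Rightarrow> nat"
    and A0 :: "'m \<Rightarrow> complex mat"
    and A :: "'m \<Rightarrow> 'm \<Rightarrow> complex mat"
    and i :: "'m \<Rightarrow> nat"
    and lam :: "real ^ 'm"
  assumes "\<And>k. A0 k \<in> carrier_mat (n k) (n k)"
    and "\<And>k l. A k l \<in> carrier_mat (n k) (n k)"
    and "\<And>k. hermitian_mat (A0 k)"
    and "\<And>k l. hermitian_mat (A k l)"
    and "right_definite n A"
    and "\<And>k. 1 \<le> i k \<and> i k \<le> n k"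
    and "mep_fun n A0 A i lam = 0"
  shows "\<exists>U C. open U \<and> lam \<in> U \<and>
    (\<forall>N x J M. x 0 \<in> U \<and> newton_run (mep_fun n A0 A i) N x J \<and>
        M \<in> clarke_jacobian (mep_fun n A0 A i) (x N) \<longrightarrow> invertible M) \<and>
    (\<forall>x J. x 0 \<in> U \<and> (\<forall>N. newton_run (mep_fun n A0 A i) N x J) \<longrightarrow>
        x \<longlonglongrightarrow> lam \<and>
        (\<forall>j. norm (x (Suc j) - lam) \<le> C * (norm (x j - lam))\<^sup>2))"
proof -
  interpret hermitian_mep n A0 A i by unfold_locales (use assms in auto)
  show ?thesis
  proof (rule semismooth_newton[where K = "\<lambda>k. form_gradient k ` unit_vecs (n k)" and G = eigen_gradients])
    show "eigen_gradients k x \<subseteq> form_gradient k ` unit_vecs (n k)" for k x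
      by (auto simp: eigen_gradients_def)
    show "0 < Determinants.det M" if "\<And>k. M $ k \<in> form_gradient k ` unit_vecs (n k)" for M
      by (rule right_definite_det_pos[OF assms(5) that])
  qed (fact compact_form_gradients eigen_gradients_nonempty eigen_gradients_closed_graph
      eigenvalue_quadratic_remainder assms(7))+
qed

end
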